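(* Let $\mathcal{F}_1$ be the class of all $f\in\mathcal{A}$ for which there exists $g\in\mathcal{A}$ with $\operatorname{Re}\bigl(f(z)/g(z)\bigr)>0$ and $\operatorname{Re}\bigl(g(z)/(z+z^2/2)\bigr)>0$ for all $z\in\mathbb{D}$. Write $R_{\mathcal{G}}$ for the $\mathcal{G}$-radius $R_{\mathcal{G}}(\mathcal{F}_1)$ of $\mathcal{F}_1$. Then the following (sharp) radii results hold for $\mathcal{F}_1$: (i) For any $0\le\alpha<1$, the radius $R_{\mathcal{S}^*(\alpha)}$ is the smallest positive root of the equation $(\alpha-2)r^3-(2\alpha+2)r^2+(10-\alpha)r+2\alpha-2=0$. (ii) The radius $R_{\mathcal{S}^*_L}$ ($\approx 0.0918$) is the smallest positive root of the equation $(2-\sqrt2)r^3-(2+2\sqrt2)r^2+(\sqrt2-10)r+2\sqrt2-2=0$. (iii) $R_{\mathcal{S}^*_P}=R_{\mathcal{S}^*(1/2)}$ ($\approx 0.1092$). (iv) $R_{\mathcal{S}^*_e}=R_{\mathcal{S}^*(1/e)}$ ($\approx 0.1370$). (v) $R_{\mathcal{S}^*_{\sin}}=R_{\mathcal{S}^*(1-\sin 1)}$ ($\approx 0.17969$). (vi) $R_{\mathcal{S}^*_{\mathrm{lune}}}=R_{\mathcal{S}^*(\sqrt2-1)}$ ($\approx 0.12734$). (vii) $R_{\mathcal{S}^*_R}=R_{\mathcal{S}^*(2(\sqrt2-1))}$ ($\approx 0.0380$). (viii) $R_{\mathcal{S}^*_C}=R_{\mathcal{S}^*(1/3)}$ ($\approx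 0.14418$).
   Context: Notation: $\mathbb{D}_r=\{z\in\mathbb{C}:|z|<r\}$ and $\mathbb{D}=\mathbb{D}_1$. $\mathcal{A}$ is the set of analytic functions $f:\mathbb{D}\to\mathbb{C}$ with $f(0)=0$ and $f'(0)=1$. $\mathcal{S}\subset\mathcal{A}$ is the subclass of univalent (injective) functions. Quotients such as $f(z)/g(z)$ and $g(z)/(z+z^2/2)$ are understood at $z=0$ by their analytic extension (value $1$). For a function $f$, put $s_f(z)=zf'(z)/f(z)$ (with $s_f(0)=1$). For $0\le\alpha<1$, $\mathcal{S}^*(\alpha)$ (starlike functions of order $\alpha$) is the class of $f\in\mathcal{S}$ with $\operatorname{Re}(s_f(z))>\alpha$ for all $z\in\mathbb{D}$. Subordination: for analytic $f,g$ on $\mathbb{D}$, $f\prec g$ means there is an analytic $\omega:\mathbb{D}\to\mathbb{D}$ with $\omega(0)=0$ and $f(z)=g(\omega(z))$ for all $z\in\mathbb{D}$. For an analytic $\varphi$ on $\mathbb{D}$ let $\mathcal{S}^*(\varphi)=\{f\in\mathcal{A}: s_f\prec\varphi\}$. The following special classes are used (principal branches): - $\mathcal{S}^*_L=\mathcal{S}^*(\varphi_1)$ with $\varphi_1(z)=\sqrt{1+z}$; - $\mathcal{S}^*_e=\mathcal{S}^*(\varphi_2)$ with $\varphi_2(z)=e^z$; - $\mathcal{S}^*_C=\mathcal{S}^*(\varphi_3)$ with $\varphi_3(z)=1+\tfrac43 z+\tfrac23 z^2$; - $\mathcal{S}^*_{\sin}=\mathcal{S}^*(\varphi_4)$ with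 $\varphi_4(z)=1+\sin z$; - $\mathcal{S}^*_{\mathrm{lune}}=\mathcal{S}^*(\varphi_5)$ with $\varphi_5(z)=z+\sqrt{1+z^2}$; - $\mathcal{S}^*_R=\mathcal{S}^*(\varphi_6)$ with $\varphi_6(z)=1+\dfrac{kz+z^2}{k^2-kz}$, $k=\sqrt2+1$; - $\mathcal{S}^*_P=\mathcal{S}^*(\varphi_7)$ with $\varphi_7(z)=1+\dfrac{2}{\pi^2}\Bigl(\log\dfrac{1+\sqrt z}{1-\sqrt z}\Bigr)^2$. Radius: for a class $\mathcal{F}\subset\mathcal{A}$ and a class $\mathcal{G}\subset\mathcal{A}$ characterised by a property, the $\mathcal{G}$-radius $R_{\mathcal{G}}(\mathcal{F})$ is the largest number $R\in[0,1]$ such that every $f\in\mathcal{F}$ has the property defining $\mathcal{G}$ in the disk $\mathbb{D}_r$ for each $0<r<R$; that is, the function $z\mapsto r^{-1}f(rz)$ on $\mathbb{D}$ belongs to $\mathcal{G}$ for each $0<r<R$. "Sharp" means that the stated number is this largest value. The decimal values are approximate numerical values only. *)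

theory Defs
  imports "HOL-Complex_Analysis.Complex_Analysis"
begin

text \<open>Functions on the unit disk are total functions on the complex numbers; every notion
  below only looks at their values on the open unit disk.\<close>

abbreviation unit_disk :: "complex set" where
  "unit_disk \<equiv> ball 0 1"

definition class_A :: "(complex \<Rightarrow> complex) set" where
  "class_A = {f. f holomorphic_on unit_disk \<and> f 0 = 0 \<and> deriv f 0 = 1}"

definition class_S :: "(complex \<Rightarrow> complex) set" where
  "class_S = {f \<in> class_A. inj_on f unit_disk}"

text \<open>For \<open>f\<close> and \<open>g\<close> in \<open>class_A\<close> the quotient has a removable singularity at 0, where its
  analytic extension takes the value 1.\<close>

definition quotient_ext :: "(complex \<Rightarrow> complex) \<Rightarrow> (complex \<Rightarrow> complex) \<Rightarrow> complex \<Rightarrow> complex" where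
  "quotient_ext f g z = (if z = 0 then 1 else f z / g z)"

definition s_fun :: "(complex \<Rightarrow> complex) \<Rightarrow> complex \<Rightarrow> complex" where
  "s_fun f z = (if z = 0 then 1 else z * deriv f z / f z)"

definition starlike_order :: "real \<Rightarrow> (complex \<Rightarrow> complex) set" where
  "starlike_order \<alpha> = {f \<in> class_S. \<forall>z\<in>unit_disk. Re (s_fun f z) > \<alpha>}"

definition subordinate :: "(complex \<Rightarrow> complex) \<Rightarrow> (complex \<Rightarrow> complex) \<Rightarrow> bool"
    (infix "\<prec>\<^sub>D" 50) where
  "f \<prec>\<^sub>D g \<longleftrightarrow> f holomorphic_on unit_disk \<and> g holomorphic_on unit_disk \<and>
     (\<exists>\<omega>. \<omega> holomorphic_on unit_disk \<and> \<omega> ` unit_disk \<subseteq> unit_disk \<and> \<omega> 0 = 0 \<and>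
          (\<forall>z\<in>unit_disk. f z = g (\<omega> z)))"

definition starlike_sub :: "(complex \<Rightarrow> complex) \<Rightarrow> (complex \<Rightarrow> complex) set" where
  "starlike_sub \<phi> = {f \<in> class_A. s_fun f \<prec>\<^sub>D \<phi>}"

definition starlike_L :: "(complex \<Rightarrow> complex) set" where
  "starlike_L = starlike_sub (\<lambda>z. csqrt (1 + z))"

definition starlike_e :: "(complex \<Rightarrow> complex) set" where
  "starlike_e = starlike_sub (\<lambda>z. exp z)"

definition starlike_C :: "(complex \<Rightarrow> complex) set" where
  "starlike_C = starlike_sub (\<lambda>z. 1 + 4 / 3 * z + 2 / 3 * z\<^sup>2)"

definition starlike_sin :: "(complex \<Rightarrow> complex) set" where
  "starlike_sin = starlike_sub (\<lambda>z. 1 + sin z)"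

definition starlike_lune :: "(complex \<Rightarrow> complex) set" where
  "starlike_lune = starlike_sub (\<lambda>z. z + csqrt (1 + z\<^sup>2))"

definition starlike_R :: "(complex \<Rightarrow> complex) set" where
  "starlike_R = starlike_sub
     (\<lambda>z. let k = complex_of_real (sqrt 2 + 1) in 1 + (k * z + z\<^sup>2) / (k\<^sup>2 - k * z))"

text \<open>The jump of \<^const>\<open>csqrt\<close> on the negative real axis is harmless in the next definition:
  replacing the root by its negative only changes the sign of the logarithm, which is squared.\<close>

definition starlike_P :: "(complex \<Rightarrow> complex) set" where
  "starlike_P = starlike_sub
     (\<lambda>z. 1 + complex_of_real (2 / pi\<^sup>2) * (Ln ((1 + csqrt z) / (1 - csqrt z)))\<^sup>2)"

definition dilate :: "real \<Rightarrow> (complex \<Rightarrow> complex) \<Rightarrow> complex \<Rightarrow> complex" where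
  "dilate r f z = f (of_real r * z) / of_real r"

definition radius_admissible ::
    "(complex \<Rightarrow> complex) set \<Rightarrow> (complex \<Rightarrow> complex) set \<Rightarrow> real \<Rightarrow> bool" where
  "radius_admissible G F R \<longleftrightarrow>
     0 \<le> R \<and> R \<le> 1 \<and> (\<forall>f\<in>F. \<forall>r. 0 < r \<and> r < R \<longrightarrow> dilate r f \<in> G)"

definition class_radius ::
    "(complex \<Rightarrow> complex) set \<Rightarrow> (complex \<Rightarrow> complex) set \<Rightarrow> real" where
  "class_radius G F = (GREATEST R. radius_admissible G F R)"

text \<open>The greatest admissible number always exists, so \<open>class_radius\<close> is never an unspecified
  value.\<close>

lemma class_radius_greatest:
  "radius_admissible G F (class_radius G F)"
  "radius_admissible G F R \<Longrightarrow> R \<le> class_radius G F"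
proof -
  let ?X = "{R. radius_admissible G F R}"
  have bdd: "bdd_above ?X"
    by (rule bdd_aboveI[of _ 1]) (auto simp: radius_admissible_def)
  have zero: "0 \<in> ?X"
    by (auto simp: radius_admissible_def)
  have up: "R \<le> Sup ?X" if "radius_admissible G F R" for R
    using that bdd by (intro cSup_upper) auto
  have "Sup ?X \<le> 1"
  proof (rule cSup_least)
    show "?X \<noteq> {}"
      using zero by blast
  qed (simp add: radius_admissible_def)
  moreover have "0 \<le> Sup ?X"
    using up zero by simp
  moreover have "dilate r f \<in> G" if "f \<in> F" "0 < r" "r < Sup ?X" for f r
  proof -
    obtain R where "R \<in> ?X" "r < R"
      using less_cSupD[of ?X r] zero \<open>r < Sup ?X\<close> by blast
    then show ?thesis
      using that by (auto simp: radius_admissible_def)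
  qed
  ultimately have adm: "radius_admissible G F (Sup ?X)"
    by (auto simp: radius_admissible_def)
  then have eq: "class_radius G F = Sup ?X"
    unfolding class_radius_def by (intro Greatest_equality up)
  show "radius_admissible G F (class_radius G F)"
    using adm eq by simp
  show "radius_admissible G F R \<Longrightarrow> R \<le> class_radius G F"
    using up eq by simp
qed

text \<open>Where \<open>g\<close> vanishes at some point other than 0, the HOL quotient is 0 there, so the
  strict inequalities correctly exclude such \<open>g\<close>.\<close>

definition class_F1 :: "(complex \<Rightarrow> complex) set" where
  "class_F1 = {f \<in> class_A. \<exists>g\<in>class_A.
     (\<forall>z\<in>unit_disk. Re (quotient_ext f g z) > 0) \<and>
     (\<forall>z\<in>unit_disk. Re (quotient_ext g (\<lambda>z. z + z\<^sup>2 / 2) z) > 0)}"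

definition smallest_positive_root :: "(real \<Rightarrow> real) \<Rightarrow> real \<Rightarrow> bool" where
  "smallest_positive_root p r \<longleftrightarrow>
     0 < r \<and> p r = 0 \<and> (\<forall>s. 0 < s \<and> p s = 0 \<longrightarrow> r \<le> s)"

end

theory Submission
  imports Defs
begin

text \<open>Every \<open>f\<close> in the class is \<open>p q (z + z\<^sup>2/2)\<close> with \<open>p\<close> and \<open>q\<close> of positive real part, so
  \<open>s_fun f z = 1 + z/(2 + z) + z p'/p + z q'/q\<close>. By Schwarz--Pick the last two terms are each at
  most \<open>2r/(1 - r\<^sup>2)\<close> for \<open>\<bar>z\<bar> = r\<close>, so \<open>s_fun f\<close> maps the disk of radius \<open>r\<close> into the disk about 1
  of radius \<open>r/(2 - r) + 4r/(1 - r\<^sup>2)\<close>. With \<open>\<alpha> = \<phi> (-1)\<close>, each of the regions in (iii)--(viii)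
  contains the disk about 1 of radius \<open>1 - \<alpha>\<close> and omits \<open>\<alpha>\<close>; hence the radius is the same as
  that of order \<open>\<alpha>\<close>. In (ii) the boundary is met on the right at \<open>\<surd>2\<close> instead, and a disk about 1 is
  too large; the disk centred at \<open>1 - r\<^sup>2/(4 - r\<^sup>2)\<close> is used. The function
  \<open>((1 + z)/(1 - z))\<^sup>2 (z + z\<^sup>2/2)\<close> shows sharpness at \<open>z = -r\<close>, and at \<open>z = r\<close> for (ii).\<close>

section \<open>The logarithmic derivative on the class\<close>

text \<open>Dividing out the zero at 0 leaves a holomorphic \<open>h\<close>, so that the value 1
  prescribed at 0 in \<open>s_fun\<close> and \<open>quotient_ext\<close> becomes the value of a
  formula that is holomorphic there.\<close>

lemma class_A_factor:
  assumes "f \<in> class_A"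
  obtains h where "h holomorphic_on unit_disk" "h 0 = 1" "\<And>z. z \<in> unit_disk \<Longrightarrow> f z = z * h z"
proof -
  have f: "f holomorphic_on unit_disk" "f 0 = 0" "deriv f 0 = 1"
    using assms by (auto simp: class_A_def)
  obtain h where "h holomorphic_on unit_disk" "\<And>z. norm z < 1 \<Longrightarrow> f z = z * h z" "deriv f 0 = h 0"
    using Schwarz3[OF f(1,2)] by blast
  then show ?thesis
    using that[of h] f(3) by (simp add: dist_norm)
qed

lemma deriv_factor:
  assumes h: "h holomorphic_on unit_disk" and f: "\<And>z. z \<in> unit_disk \<Longrightarrow> f z = z * h z"
    and z: "z \<in> unit_disk"
  shows "(f has_field_derivative h z + z * deriv h z) (at z)"
proof -
  have "(h has_field_derivative deriv h z) (at z)"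
    using holomorphic_derivI[OF h open_ball z] .
  then have "((\<lambda>z. z * h z) has_field_derivative h z + z * deriv h z) (at z)"
    by (auto intro!: derivative_eq_intros)
  then show ?thesis
    by (rule has_field_derivative_transform_within_open[OF _ open_ball z]) (simp add: f)
qed

lemma factor_in_class_A:
  assumes h: "h holomorphic_on unit_disk" "h 0 = 1" and f: "\<And>z. z \<in> unit_disk \<Longrightarrow> f z = z * h z"
  shows "f \<in> class_A"
proof -
  have "f holomorphic_on unit_disk \<longleftrightarrow> (\<lambda>z. z * h z) holomorphic_on unit_disk"
    by (rule holomorphic_cong) (auto simp: f)
  then have "f holomorphic_on unit_disk"
    using h(1) by (auto intro!: holomorphic_intros)
  moreover have "deriv f 0 = 1"
    using DERIV_imp_deriv[OF deriv_factor[OF h(1) f, of 0]] h(2) by simp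
  ultimately show ?thesis
    using f[of 0] by (simp add: class_A_def)
qed

text \<open>Logarithmic derivative of \<open>z * h z\<close>. At 0 both sides are 1, which is why
  the value fixed in \<open>s_fun\<close> is the analytic extension.\<close>

lemma s_fun_factor:
  assumes h: "h holomorphic_on unit_disk" and f: "\<And>z. z \<in> unit_disk \<Longrightarrow> f z = z * h z"
    and z: "z \<in> unit_disk" and nz: "h z \<noteq> 0"
  shows "s_fun f z = 1 + z * deriv h z / h z"
  using DERIV_imp_deriv[OF deriv_factor[OF h f z]] f[OF z] nz
  by (auto simp: s_fun_def field_simps)

lemma s_fun_holomorphic:
  assumes "f \<in> class_A" "\<And>z. z \<in> unit_disk \<Longrightarrow> z \<noteq> 0 \<Longrightarrow> f z \<noteq> 0"
  shows "s_fun f holomorphic_on unit_disk"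
proof -
  obtain h where h: "h holomorphic_on unit_disk" "h 0 = 1" "\<And>z. z \<in> unit_disk \<Longrightarrow> f z = z * h z"
    using class_A_factor[OF assms(1)] by blast
  have nz: "h z \<noteq> 0" if "z \<in> unit_disk" for z
    using assms(2)[OF that] h(3)[OF that] h(2) by (cases "z = 0") auto
  have "s_fun f holomorphic_on unit_disk \<longleftrightarrow>
      (\<lambda>z. 1 + z * deriv h z / h z) holomorphic_on unit_disk"
    by (rule holomorphic_cong) (auto intro!: s_fun_factor h nz)
  then show ?thesis
    using h(1) nz by (auto intro!: holomorphic_intros holomorphic_deriv)
qed

lemma dilate_in_class_A:
  assumes f: "f \<in> class_A" and r: "0 < r" "r \<le> 1"
  shows "dilate r f \<in> class_A"
proof -
  obtain h where h: "h holomorphic_on unit_disk" "h 0 = 1" "\<And>z. z \<in> unit_disk \<Longrightarrow> f z = z * h z"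
    using class_A_factor[OF f] by blast
  have sub: "of_real r * z \<in> unit_disk" if "z \<in> unit_disk" for z :: complex
  proof -
    have "r * norm z \<le> norm z" using r by (simp add: mult_left_le_one_le)
    then show ?thesis using that r by (simp add: norm_mult)
  qed
  have "(h \<circ> (\<lambda>z. of_real r * z)) holomorphic_on unit_disk"
    by (rule holomorphic_on_compose_gen[OF _ h(1)]) (use sub in \<open>auto intro!: holomorphic_intros\<close>)
  then show ?thesis
    by (rule factor_in_class_A) (use sub h r in \<open>auto simp: dilate_def\<close>)
qed

lemma s_fun_dilate:
  assumes f: "f holomorphic_on unit_disk" and r: "0 < r" and z: "of_real r * z \<in> unit_disk"
  shows "s_fun (dilate r f) z = s_fun f (of_real r * z)"
proof -
  have "(f has_field_derivative deriv f (of_real r * z)) (at (of_real r * z))"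
    using holomorphic_derivI[OF f open_ball z] .
  then have "((\<lambda>z. f (of_real r * z)) has_field_derivative deriv f (of_real r * z) * of_real r) (at z)"
    by (rule DERIV_chain2) (auto intro!: derivative_eq_intros)
  then have "((\<lambda>z. f (of_real r * z) / of_real r) has_field_derivative
      (deriv f (of_real r * z) * of_real r) / of_real r) (at z)"
    by (rule DERIV_cdivide)
  then have "deriv (dilate r f) z = deriv f (of_real r * z)"
    using r by (simp add: dilate_def[abs_def] DERIV_imp_deriv)
  then show ?thesis
    using r by (auto simp: s_fun_def dilate_def)
qed

text \<open>The Schwarz lemma is applied to \<open>p\<close> transported by the disk automorphism that sends 0 to
  \<open>z\<close> and by the half-plane-to-disk map that sends \<open>p z\<close> to 0.\<close>

lemma norm_log_deriv_le:
  assumes p: "p holomorphic_on unit_disk" and pos: "\<And>z. z \<in> unit_disk \<Longrightarrow> Re (p z) > 0"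
    and z: "z \<in> unit_disk"
  shows "norm (deriv p z / p z) \<le> 2 / (1 - (norm z)\<^sup>2)"
proof -
  define T where "T = (\<lambda>w. (w + z) / (1 + cnj z * w))"
  define F where "F = (\<lambda>w. (p (T w) - p z) / (p (T w) + cnj (p z)))"
  have nz: "norm z < 1" using z by simp
  have den: "1 + cnj z * w \<noteq> 0" if "norm w < 1" for w
  proof
    assume "1 + cnj z * w = 0"
    then have "cnj z * w = -1" by (simp add: add_eq_0_iff)
    then have "norm z * norm w = 1" by (metis complex_mod_cnj norm_minus_cancel norm_mult norm_one)
    moreover have "norm z * norm w < 1 * 1" using nz that by (intro mult_strict_mono') auto
    ultimately show False by simp
  qed
  have Tin: "T w \<in> unit_disk" if "norm w < 1" for w
  proof -
    have eq: "(norm (1 + cnj z * w))\<^sup>2 - (norm (w + z))\<^sup>2 = (1 - (norm z)\<^sup>2) * (1 - (norm w)\<^sup>2)"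
      by (simp only: cmod_power2) (simp add: power2_eq_square algebra_simps)
    have "(1 - (norm z)\<^sup>2) * (1 - (norm w)\<^sup>2) > 0"
      using nz that by (intro mult_pos_pos) (auto simp: power_less_one_iff abs_square_less_1)
    then have "(norm (w + z))\<^sup>2 < (norm (1 + cnj z * w))\<^sup>2" using eq by linarith
    then have "norm (w + z) < norm (1 + cnj z * w)" by (rule power2_less_imp_less) simp
    then show ?thesis using den[OF that] by (simp add: T_def norm_divide)
  qed
  have Thol: "T holomorphic_on unit_disk"
    unfolding T_def using den by (auto intro!: holomorphic_intros)
  have pT: "(\<lambda>w. p (T w)) holomorphic_on unit_disk"
    using holomorphic_on_compose_gen[OF Thol p] Tin by (simp add: o_def image_subset_iff)
  have den2: "p a + cnj (p z) \<noteq> 0" if "a \<in> unit_disk" for a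
  proof -
    have "Re (p a + cnj (p z)) > 0" using pos[OF that] pos[OF z] by simp
    then show ?thesis by (metis less_irrefl zero_complex.sel(1))
  qed
  have Fhol: "F holomorphic_on unit_disk"
    unfolding F_def using Tin den2 pT by (auto intro!: holomorphic_intros)
  have T0: "T 0 = z" by (simp add: T_def)
  have F0: "F 0 = 0" by (simp add: F_def T0)
  have Flt: "norm (F w) < 1" if "norm w < 1" for w
  proof -
    let ?a = "p (T w)" and ?b = "p z"
    have eq: "(norm (?a + cnj ?b))\<^sup>2 - (norm (?a - ?b))\<^sup>2 = 4 * (Re ?a * Re ?b)"
      by (simp only: cmod_power2) (simp add: power2_eq_square algebra_simps)
    have "Re ?a * Re ?b > 0" using pos[OF Tin[OF that]] pos[OF z] by simp
    then have "(norm (?a - ?b))\<^sup>2 < (norm (?a + cnj ?b))\<^sup>2" using eq by linarith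
    then have "norm (?a - ?b) < norm (?a + cnj ?b)" by (rule power2_less_imp_less) simp
    then show ?thesis using den2[OF Tin[OF that]] by (simp add: F_def norm_divide)
  qed
  have "(T has_field_derivative 1 - cnj z * z) (at 0)"
    unfolding T_def by (auto intro!: derivative_eq_intros simp: algebra_simps)
  moreover have "(p has_field_derivative deriv p z) (at (T 0))"
    using holomorphic_derivI[OF p open_ball z] T0 by simp
  ultimately have "((\<lambda>w. p (T w)) has_field_derivative deriv p z * (1 - cnj z * z)) (at 0)"
    by (intro DERIV_chain2[where f = p])
  then have "(F has_field_derivative
      ((deriv p z * (1 - cnj z * z)) * (p (T 0) + cnj (p z))
        - (p (T 0) - p z) * (deriv p z * (1 - cnj z * z)))
      / ((p (T 0) + cnj (p z)) * (p (T 0) + cnj (p z)))) (at 0)"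
    unfolding F_def using den2[OF z] T0 by (auto intro!: derivative_eq_intros)
  then have "deriv F 0 = deriv p z * (1 - cnj z * z) / (p z + cnj (p z))"
    using den2[OF z] by (simp add: T0 DERIV_imp_deriv)
  also have "1 - cnj z * z = of_real (1 - (norm z)\<^sup>2)"
    by (metis complex_norm_square mult.commute of_real_1 of_real_diff)
  also have "p z + cnj (p z) = of_real (2 * Re (p z))"
    by (simp add: complex_add_cnj)
  finally have dF: "norm (deriv F 0) = norm (deriv p z) * (1 - (norm z)\<^sup>2) / (2 * Re (p z))"
    using nz pos[OF z] by (simp add: norm_mult norm_divide abs_square_le_1 less_imp_le del: of_real_diff of_real_mult)
  \<comment> \<open>The Schwarz lemma gives the half-plane form of Schwarz--Pick, with
    \<open>Re (p z)\<close> on the right; weakening it to \<open>norm (p z)\<close> turns it into a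
    bound on the logarithmic derivative.\<close>
  have "norm (deriv F 0) \<le> 1"
    using Schwarz_Lemma(2)[OF Fhol F0 Flt, of 0] by simp
  then have "norm (deriv p z) * (1 - (norm z)\<^sup>2) \<le> 2 * Re (p z)"
    using dF pos[OF z] by (simp add: field_simps)
  also have "\<dots> \<le> 2 * norm (p z)" using complex_Re_le_cmod[of "p z"] by simp
  finally have "norm (deriv p z) * (1 - (norm z)\<^sup>2) \<le> 2 * norm (p z)" .
  moreover have "1 - (norm z)\<^sup>2 > 0" using nz by (simp add: abs_square_less_1)
  moreover have "norm (p z) > 0" using pos[OF z] by auto
  ultimately show ?thesis by (simp add: norm_divide field_simps)
qed

section \<open>Factorisation and logarithmic derivative on \<open>class_F1\<close>\<close>

lemma two_plus_nonzero:
  fixes z :: complex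
  assumes "z \<in> unit_disk"
  shows "2 + z \<noteq> 0" "1 + z / 2 \<noteq> 0"
proof -
  have "z \<noteq> -2"
    using assms by auto
  then show "2 + z \<noteq> 0"
    by (simp add: add_eq_0_iff)
  then show "1 + z / 2 \<noteq> 0"
    by (auto simp: field_simps)
qed

text \<open>The factors are p = f/g and q = g/(z + z^2/2), with the common factor z cancelled in
  each quotient so that they are holomorphic at 0.\<close>

lemma class_F1_factor:
  assumes "f \<in> class_F1"
  obtains p q where "p holomorphic_on unit_disk" "\<And>z. z \<in> unit_disk \<Longrightarrow> Re (p z) > 0" "p 0 = 1"
    "q holomorphic_on unit_disk" "\<And>z. z \<in> unit_disk \<Longrightarrow> Re (q z) > 0" "q 0 = 1"
    "\<And>z. z \<in> unit_disk \<Longrightarrow> f z = z * (p z * q z * (1 + z / 2))"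
proof -
  obtain g where g: "g \<in> class_A" and f: "f \<in> class_A"
    and fg: "\<And>z. z \<in> unit_disk \<Longrightarrow> Re (quotient_ext f g z) > 0"
    and gg: "\<And>z. z \<in> unit_disk \<Longrightarrow> Re (quotient_ext g (\<lambda>z. z + z\<^sup>2 / 2) z) > 0"
    using assms by (auto simp: class_F1_def)
  obtain a where a: "a holomorphic_on unit_disk" "a 0 = 1" "\<And>z. z \<in> unit_disk \<Longrightarrow> f z = z * a z"
    using class_A_factor[OF f] by blast
  obtain b where b: "b holomorphic_on unit_disk" "b 0 = 1" "\<And>z. z \<in> unit_disk \<Longrightarrow> g z = z * b z"
    using class_A_factor[OF g] by blast
  note two = two_plus_nonzero
  have q: "quotient_ext g (\<lambda>z. z + z\<^sup>2 / 2) z = b z / (1 + z / 2)" if "z \<in> unit_disk" for z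
  proof (cases "z = 0")
    case False
    have "z + z\<^sup>2 / 2 = z * (1 + z / 2)" by (simp add: power2_eq_square algebra_simps)
    then show ?thesis using False b(3)[OF that] by (simp add: quotient_ext_def)
  qed (use b in \<open>auto simp: quotient_ext_def\<close>)
  \<comment> \<open>A zero of \<open>b\<close> would make the second quotient 0, against its
    positive real part.\<close>
  have bnz: "b z \<noteq> 0" if "z \<in> unit_disk" for z
    using gg[OF that] q[OF that] by auto
  have p: "quotient_ext f g z = a z / b z" if "z \<in> unit_disk" for z
    using a(2) a(3)[OF that] b(2) b(3)[OF that] bnz[OF that] by (auto simp: quotient_ext_def)
  show ?thesis
  proof (rule that[of "\<lambda>z. a z / b z" "\<lambda>z. b z / (1 + z / 2)"])
    show "(\<lambda>z. a z / b z) holomorphic_on unit_disk"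
      using a b bnz by (auto intro!: holomorphic_intros)
    show "(\<lambda>z. b z / (1 + z / 2)) holomorphic_on unit_disk"
      using b two by (auto intro!: holomorphic_intros)
    show "f z = z * (a z / b z * (b z / (1 + z / 2)) * (1 + z / 2))" if "z \<in> unit_disk" for z
      using a(3)[OF that] bnz[OF that] two[OF that] by simp
  qed (use fg gg p q a b in auto)
qed

lemma class_F1_subset_class_A: "class_F1 \<subseteq> class_A"
  by (auto simp: class_F1_def)

lemma s_fun_class_F1_holomorphic:
  assumes "f \<in> class_F1"
  shows "s_fun f holomorphic_on unit_disk"
proof (rule s_fun_holomorphic)
  obtain p q where "\<And>z. z \<in> unit_disk \<Longrightarrow> Re (p z) > 0" "\<And>z. z \<in> unit_disk \<Longrightarrow> Re (q z) > 0"
    and f: "\<And>z. z \<in> unit_disk \<Longrightarrow> f z = z * (p z * q z * (1 + z / 2))"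
    using class_F1_factor[OF assms] by metis
  then have "p z \<noteq> 0" "q z \<noteq> 0" if "z \<in> unit_disk" for z
    using that by (metis less_irrefl zero_complex.sel(1))+
  moreover note two_plus_nonzero
  ultimately show "f z \<noteq> 0" if "z \<in> unit_disk" "z \<noteq> 0" for z
    using f[OF that(1)] that by auto
qed (use assms class_F1_subset_class_A in auto)

lemma s_fun_product:
  assumes p: "p holomorphic_on unit_disk" and q: "q holomorphic_on unit_disk"
    and f: "\<And>z. z \<in> unit_disk \<Longrightarrow> f z = z * (p z * q z * (1 + z / 2))"
    and z: "z \<in> unit_disk" and nz: "p z \<noteq> 0" "q z \<noteq> 0"
  shows "s_fun f z = 1 + z / (2 + z) + z * (deriv p z / p z) + z * (deriv q z / q z)"
proof -
  note two = two_plus_nonzero[OF z]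
  let ?h = "\<lambda>z. p z * q z * (1 + z / 2)"
  have "(p has_field_derivative deriv p z) (at z)" "(q has_field_derivative deriv q z) (at z)"
    using holomorphic_derivI[OF _ open_ball z] p q by blast+
  then have "(?h has_field_derivative
      (deriv p z * q z + p z * deriv q z) * (1 + z / 2) + p z * q z / 2) (at z)"
    by (auto intro!: derivative_eq_intros simp: algebra_simps)
  then have "deriv ?h z = (deriv p z * q z + p z * deriv q z) * (1 + z / 2) + p z * q z / 2"
    by (rule DERIV_imp_deriv)
  moreover have "?h holomorphic_on unit_disk"
    using p q by (auto intro!: holomorphic_intros)
  then have "s_fun f z = 1 + z * deriv ?h z / ?h z"
    by (rule s_fun_factor[OF _ f z]) (use nz two in auto)
  ultimately show ?thesis
    using nz two by (simp add: divide_simps) (simp add: algebra_simps)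
qed

text \<open>Only the contributions of p and q are estimated. The term z/(2 + z) stays exact, because
  the bound towards the left and the lemniscate case treat it differently.\<close>

lemma s_fun_class_F1:
  assumes "f \<in> class_F1" and z: "z \<in> unit_disk"
  shows "norm (s_fun f z - (1 + z / (2 + z))) \<le> 4 * norm z / (1 - (norm z)\<^sup>2)"
proof -
  obtain p q where p: "p holomorphic_on unit_disk" "\<And>z. z \<in> unit_disk \<Longrightarrow> Re (p z) > 0"
    and q: "q holomorphic_on unit_disk" "\<And>z. z \<in> unit_disk \<Longrightarrow> Re (q z) > 0"
    and f: "\<And>z. z \<in> unit_disk \<Longrightarrow> f z = z * (p z * q z * (1 + z / 2))"
    using class_F1_factor[OF assms(1)] by metis
  have "p z \<noteq> 0" "q z \<noteq> 0"
    using p(2)[OF z] q(2)[OF z] by auto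
  then have "s_fun f z - (1 + z / (2 + z)) = z * (deriv p z / p z + deriv q z / q z)"
    using s_fun_product[OF p(1) q(1) f z] by (simp add: algebra_simps)
  also have "norm \<dots> \<le> norm z * (2 / (1 - (norm z)\<^sup>2) + 2 / (1 - (norm z)\<^sup>2))"
    unfolding norm_mult
    by (intro mult_left_mono norm_triangle_mono norm_log_deriv_le p q z) auto
  finally show ?thesis by (simp add: mult.commute)
qed

section \<open>The extremal function\<close>

definition extremal :: "complex \<Rightarrow> complex" where
  "extremal z = z * ((1 + z) / (1 - z) * ((1 + z) / (1 - z)) * (1 + z / 2))"

lemma Re_half_plane_map_pos: "Re ((1 + z) / (1 - z)) > 0" if "norm z < 1" for z :: complex
proof -
  have "z \<noteq> 1" using that by auto
  have "Re ((1 + z) * cnj (1 - z)) = 1 - (norm z)\<^sup>2"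
    by (simp only: cmod_power2) (simp add: power2_eq_square algebra_simps)
  also have "\<dots> > 0" using that by (simp add: abs_square_less_1)
  finally have "Re ((1 + z) * cnj (1 - z)) > 0" .
  then show ?thesis
    using \<open>z \<noteq> 1\<close> by (subst complex_div_cnj) (auto simp: zero_less_divide_iff)
qed

lemma half_plane_map_holomorphic: "(\<lambda>z. (1 + z) / (1 - z)) holomorphic_on unit_disk"
  by (auto intro!: holomorphic_intros)

text \<open>The witness \<open>?g\<close> carries one of the two half-plane factors, so both
  quotients equal (1 + z)/(1 - z).\<close>

lemma extremal_in_class_F1: "extremal \<in> class_F1"
proof -
  let ?p = "\<lambda>z::complex. (1 + z) / (1 - z)"
  let ?g = "\<lambda>z. z * (?p z * (1 + z / 2))"
  note two = two_plus_nonzero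
  have pnz: "?p z \<noteq> 0" if "z \<in> unit_disk" for z
    using Re_half_plane_map_pos[of z] that by fastforce
  have "extremal \<in> class_A"
    by (rule factor_in_class_A[of "\<lambda>z. ?p z * ?p z * (1 + z / 2)"])
       (use half_plane_map_holomorphic in \<open>auto simp: extremal_def intro!: holomorphic_intros\<close>)
  moreover have "?g \<in> class_A"
    by (rule factor_in_class_A[of "\<lambda>z. ?p z * (1 + z / 2)"])
       (use half_plane_map_holomorphic in \<open>auto intro!: holomorphic_intros\<close>)
  moreover have "quotient_ext extremal ?g z = ?p z" if "z \<in> unit_disk" for z
  proof (cases "z = 0")
    case False
    have "extremal z = ?p z * ?g z" by (simp only: extremal_def mult_ac)
    moreover have "?g z \<noteq> 0" using False pnz[OF that] two[OF that] by simp
    ultimately show ?thesis using False by (simp only: quotient_ext_def if_False not_False_eq_True nonzero_mult_div_cancel_right)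
  qed (simp add: quotient_ext_def)
  moreover have "quotient_ext ?g (\<lambda>z. z + z\<^sup>2 / 2) z = ?p z" if "z \<in> unit_disk" for z
  proof (cases "z = 0")
    case False
    have "z + z\<^sup>2 / 2 = z * (1 + z / 2)" by (simp add: power2_eq_square algebra_simps)
    then show ?thesis using False two[OF that] by (simp add: quotient_ext_def)
  qed (simp add: quotient_ext_def)
  ultimately show ?thesis
    unfolding class_F1_def using Re_half_plane_map_pos by (auto intro!: bexI[of _ ?g])
qed

text \<open>At real points (1 + z)/(1 - z) has logarithmic derivative 2/(1 - x^2), which is equality
  in \<open>norm_log_deriv_le\<close>; both factors contribute it with the same sign.\<close>

lemma s_fun_extremal:
  assumes "\<bar>x\<bar> < 1"
  shows "s_fun extremal (of_real x) = of_real (1 + x / (2 + x) + 4 * x / (1 - x\<^sup>2))"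
proof -
  let ?p = "\<lambda>z::complex. (1 + z) / (1 - z)" and ?z = "complex_of_real x"
  have nz: "1 - ?z \<noteq> 0" "1 + ?z \<noteq> 0" "1 - ?z\<^sup>2 \<noteq> 0"
    using assms by (auto simp: complex_eq_iff power2_eq_1_iff simp flip: of_real_power)
  have "(?p has_field_derivative 2 / (1 - ?z)\<^sup>2) (at ?z)"
    using nz by (auto intro!: derivative_eq_intros simp: power2_eq_square)
  then have d: "deriv ?p ?z = 2 / (1 - ?z)\<^sup>2" by (rule DERIV_imp_deriv)
  have "deriv ?p ?z / ?p ?z = 2 / (1 - ?z\<^sup>2)"
    unfolding d using nz by (simp add: divide_simps) (simp add: power2_eq_square algebra_simps)
  moreover have "s_fun extremal ?z =
      1 + ?z / (2 + ?z) + ?z * (deriv ?p ?z / ?p ?z) + ?z * (deriv ?p ?z / ?p ?z)"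
    by (rule s_fun_product[OF half_plane_map_holomorphic half_plane_map_holomorphic])
       (use assms nz in \<open>auto simp: extremal_def\<close>)
  ultimately show ?thesis by (simp add: algebra_simps)
qed

section \<open>Univalence of starlike functions\<close>

text \<open>Noshiro--Warschawski: along the segment from \<open>a\<close> to \<open>b\<close> the
  real part of f/(b - a) has derivative Re f' > 0, so it takes different values at the two
  ends.\<close>

lemma inj_on_Re_deriv_pos:
  assumes S: "convex S"
    and f: "\<And>z. z \<in> S \<Longrightarrow> (f has_field_derivative f' z) (at z)"
    and pos: "\<And>z. z \<in> S \<Longrightarrow> Re (f' z) > 0"
  shows "inj_on f S"
proof (rule inj_onI, rule ccontr)
  fix a b assume ab: "a \<in> S" "b \<in> S" "f a = f b" "a \<noteq> b"
  define \<phi> where "\<phi> = (\<lambda>t::real. Re (f (a + of_real t * (b - a)) / (b - a)))"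
  have "\<exists>y. (\<phi> has_real_derivative y) (at t) \<and> y > 0" if t: "0 \<le> t" "t \<le> 1" for t
  proof -
    let ?z = "a + of_real t * (b - a)"
    have "?z = (1 - t) *\<^sub>R a + t *\<^sub>R b"
      by (simp add: scaleR_conv_of_real algebra_simps)
    then have z: "?z \<in> S"
      using convexD_alt[OF S ab(1,2) t] by simp
    have "((\<lambda>w. f (a + w * (b - a))) has_field_derivative f' ?z * (b - a)) (at (of_real t))"
      by (rule DERIV_chain2[where f = f and g = "\<lambda>w. a + w * (b - a)"])
         (use f[OF z] in \<open>auto intro!: derivative_eq_intros\<close>)
    then have "((\<lambda>w. f (a + w * (b - a)) / (b - a)) has_field_derivative
        f' ?z * (b - a) / (b - a)) (at (of_real t))"
      by (rule DERIV_cdivide)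
    then have "((\<lambda>w. f (a + w * (b - a)) / (b - a)) has_field_derivative f' ?z) (at (of_real t))"
      using ab(4) by simp
    then have "((\<lambda>t. f (a + of_real t * (b - a)) / (b - a)) has_vector_derivative f' ?z) (at t)"
      by (rule has_vector_derivative_real_field)
    from bounded_linear.has_vector_derivative[OF bounded_linear_Re this]
    have "(\<phi> has_real_derivative Re (f' ?z)) (at t)"
      by (simp add: \<phi>_def has_real_derivative_iff_has_vector_derivative)
    then show ?thesis using pos[OF z] by blast
  qed
  then have "\<phi> 0 < \<phi> 1"
    using DERIV_pos_imp_increasing[OF zero_less_one] by blast
  then show False using ab by (simp add: \<phi>_def)
qed

text \<open>In the logarithmic coordinate \<open>u = Ln z\<close> the map \<open>f\<close> lifts to \<open>G\<close> with
  \<open>exp (G u) = f (exp u)\<close> and derivative \<open>s_fun f (exp u)\<close>, so \<open>G\<close> is injective on the left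
  half-plane, and it commutes with the translation by \<open>2 * pi * \<i>\<close>.\<close>

lemma starlike_inj_on:
  assumes f: "f \<in> class_A" and pos: "\<And>z. z \<in> unit_disk \<Longrightarrow> Re (s_fun f z) > 0"
  shows "inj_on f unit_disk"
proof -
  obtain h where h: "h holomorphic_on unit_disk" "h 0 = 1"
      and fh: "\<And>z. z \<in> unit_disk \<Longrightarrow> f z = z * h z"
    using class_A_factor[OF f] by blast
  \<comment> \<open>At a zero of \<open>h\<close> other than 0, division by zero would give
    \<open>s_fun f z = 0\<close>, against the positive real part.\<close>
  have nz: "h z \<noteq> 0" if "z \<in> unit_disk" for z
    using pos[OF that] fh[OF that] h(2) by (cases "z = 0") (auto simp: s_fun_def)
  have "simply_connected unit_disk"
    by (simp add: convex_imp_simply_connected)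
  then obtain L where L: "L holomorphic_on unit_disk" "\<And>z. z \<in> unit_disk \<Longrightarrow> h z = exp (L z)"
    using simply_connected_eq_holomorphic_log[OF open_ball] h(1) nz by metis
  have dL: "(L has_field_derivative deriv L z) (at z)" if "z \<in> unit_disk" for z
    using holomorphic_derivI[OF L(1) open_ball that] .
  have s: "s_fun f z = 1 + z * deriv L z" if "z \<in> unit_disk" for z
  proof -
    have "((\<lambda>z. exp (L z)) has_field_derivative exp (L z) * deriv L z) (at z)"
      using dL[OF that] by (auto intro!: derivative_eq_intros)
    then have "(h has_field_derivative exp (L z) * deriv L z) (at z)"
      by (rule has_field_derivative_transform_within_open[OF _ open_ball that]) (simp add: L)
    then show ?thesis
      using s_fun_factor[OF h(1) fh that nz[OF that]] L(2)[OF that] by (simp add: DERIV_imp_deriv)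
  qed
  define G where "G = (\<lambda>u. u + L (exp u))"
  have exp_in: "exp u \<in> unit_disk" if "Re u < 0" for u
    using that by simp
  have dG: "(G has_field_derivative s_fun f (exp u)) (at u)" if "u \<in> {u. Re u < 0}" for u
  proof -
    have u: "exp u \<in> unit_disk" using that by simp
    have "((\<lambda>u. L (exp u)) has_field_derivative deriv L (exp u) * exp u) (at u)"
      by (rule DERIV_chain2[where f = L and g = exp]) (rule dL[OF u], rule DERIV_exp)
    then show ?thesis
      unfolding G_def s[OF u] by (auto intro!: derivative_eq_intros simp: mult.commute)
  qed
  have injG: "inj_on G {u. Re u < 0}"
    by (rule inj_on_Re_deriv_pos[OF convex_halfspace_Re_lt dG]) (use pos exp_in in auto)
  have expG: "exp (G u) = f (exp u)" if "Re u < 0" for u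
    using fh[OF exp_in[OF that]] L(2)[OF exp_in[OF that]] by (simp add: G_def exp_add)
  have zero: "z = 0" if "z \<in> unit_disk" "f z = 0" for z
    using fh[OF that(1)] that nz by auto
  show ?thesis
  proof (rule inj_onI)
    fix x y assume xy: "x \<in> unit_disk" "y \<in> unit_disk" "f x = f y"
    have f0: "f 0 = 0" using fh[of 0] by simp
    show "x = y"
    \<comment> \<open>The logarithmic coordinate covers only the punctured disk, so 0 is separated
      off as the only zero of \<open>f\<close>.\<close>
    proof (cases "x = 0 \<or> y = 0")
      case True
      then show ?thesis using zero xy f0 by metis
    next
      case False
      then have R: "Re (Ln x) < 0" "Re (Ln y) < 0" using xy by auto
      have "exp (G (Ln x)) = exp (G (Ln y))"
        using R False xy by (simp add: expG)
      then obtain n :: int where n: "G (Ln x) = G (Ln y) + of_int (2 * n) * of_real pi * \<i>"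
        by (auto simp: exp_eq)
      \<comment> \<open>The shift by a multiple of the period is moved into the argument of
        \<open>G\<close>, where injectivity applies.\<close>
      let ?v = "Ln y + of_int (2 * n) * of_real pi * \<i>"
      have ev: "exp ?v = exp (Ln y)" by (subst exp_eq) (auto intro!: exI[of _ n])
      then have "G (Ln x) = G ?v" using n by (simp add: G_def)
      then have "Ln x = ?v"
        by (rule inj_onD[OF injG]) (use R in auto)
      then show ?thesis using ev False by (metis exp_Ln)
    qed
  qed
qed

section \<open>Radii for regions that contain a disk about 1\<close>

text \<open>\<open>1 - left_dev r\<close> and \<open>1 + right_dev r\<close> are the values of
  \<open>s_fun extremal\<close> at -r and r.\<close>

definition left_dev :: "real \<Rightarrow> real" where
  "left_dev r = r / (2 - r) + 4 * r / (1 - r\<^sup>2)"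

definition right_dev :: "real \<Rightarrow> real" where
  "right_dev r = r / (2 + r) + 4 * r / (1 - r\<^sup>2)"

lemma dev_tail_mono:
  fixes r s :: real
  assumes "0 \<le> r" "r < s" "s < 1"
  shows "4 * r / (1 - r\<^sup>2) < 4 * s / (1 - s\<^sup>2)"
proof -
  have "s\<^sup>2 < 1" "r\<^sup>2 \<le> s\<^sup>2" using assms by (auto simp: abs_square_less_1)
  then show ?thesis using assms by (intro frac_less) auto
qed

lemma left_dev_strict_mono:
  assumes "0 \<le> r" "r < s" "s < 1"
  shows "left_dev r < left_dev s"
  unfolding left_dev_def
  by (rule add_strict_mono[OF frac_less dev_tail_mono]) (use assms in auto)

lemma right_dev_strict_mono:
  assumes "0 \<le> r" "r < s" "s < 1"
  shows "right_dev r < right_dev s"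
proof -
  have "r / (2 + r) < s / (2 + s)" using assms by (simp add: field_simps)
  then show ?thesis
    unfolding right_dev_def by (rule add_strict_mono[OF _ dev_tail_mono]) (use assms in auto)
qed

lemma clear_denominators:
  fixes a b :: "'a::field"
  assumes "a \<noteq> 0" "b \<noteq> 0"
  shows "(x / a + y / b) * (a * b) = x * b + y * a"
  using assms by (simp add: field_simps)

text \<open>The cubic is the equation \<open>left_dev r = 1 - \<alpha>\<close> with its denominators
  cleared; these are positive on [0, 1), so both have the same solutions there.\<close>

lemma left_dev_polynomial:
  assumes "0 \<le> r" "r < 1"
  shows "(\<alpha> - 2) * r ^ 3 - (2 * \<alpha> + 2) * r ^ 2 + (10 - \<alpha>) * r + 2 * \<alpha> - 2
    = (left_dev r - (1 - \<alpha>)) * ((2 - r) * (1 - r\<^sup>2))"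
proof -
  have nz: "2 - r \<noteq> 0" "1 - r\<^sup>2 \<noteq> 0"
    using assms by (auto simp: power2_eq_1_iff)
  have "left_dev r * ((2 - r) * (1 - r\<^sup>2)) = r * (1 - r\<^sup>2) + 4 * r * (2 - r)"
    unfolding left_dev_def by (rule clear_denominators[OF nz])
  then show ?thesis
    by (simp add: left_diff_distrib) (simp add: power2_eq_square power3_eq_cube algebra_simps)
qed

lemma right_dev_polynomial:
  assumes "0 \<le> r" "r < 1"
  shows "(2 - sqrt 2) * r ^ 3 - (2 + 2 * sqrt 2) * r ^ 2 + (sqrt 2 - 10) * r + 2 * sqrt 2 - 2
    = (sqrt 2 - 1 - right_dev r) * ((2 + r) * (1 - r\<^sup>2))"
proof -
  have nz: "2 + r \<noteq> 0" "1 - r\<^sup>2 \<noteq> 0"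
    using assms by (auto simp: power2_eq_1_iff)
  have "right_dev r * ((2 + r) * (1 - r\<^sup>2)) = r * (1 - r\<^sup>2) + 4 * r * (2 + r)"
    unfolding right_dev_def by (rule clear_denominators[OF nz])
  then show ?thesis
    by (simp add: left_diff_distrib) (simp add: power2_eq_square power3_eq_cube algebra_simps)
qed

text \<open>The intermediate value theorem is applied to the cubic, since \<open>left_dev\<close>
  has a pole at 1. The cubic is 2 \<alpha> - 2 < 0 at 0 and 4 at 1.\<close>

lemma left_dev_root:
  assumes "0 \<le> \<alpha>" "\<alpha> < 1"
  obtains \<rho> where "0 < \<rho>" "\<rho> < 1" "left_dev \<rho> = 1 - \<alpha>"
proof -
  let ?p = "\<lambda>r::real. (\<alpha> - 2) * r ^ 3 - (2 * \<alpha> + 2) * r ^ 2 + (10 - \<alpha>) * r + 2 * \<alpha> - 2"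
  have "\<exists>x. 0 \<le> x \<and> x \<le> 1 \<and> ?p x = 0"
    by (rule IVT') (use assms in \<open>auto intro!: continuous_intros\<close>)
  then obtain x where x: "0 \<le> x" "x \<le> 1" "?p x = 0" by blast
  have "x \<noteq> 0" "x \<noteq> 1" using x(3) assms by auto
  then have x01: "0 < x" "x < 1" using x by auto
  then have "(2 - x) * (1 - x\<^sup>2) \<noteq> 0" by (auto simp: power2_eq_1_iff)
  then have "left_dev x = 1 - \<alpha>"
    using left_dev_polynomial[of x \<alpha>] x01 x(3) by simp
  then show ?thesis using that x01 by blast
qed

text \<open>Here the cubic falls from 2 sqrt 2 - 2 > 0 at 0 to -12 at 1.\<close>

lemma right_dev_root:
  obtains \<rho> where "0 < \<rho>" "\<rho> < 1" "right_dev \<rho> = sqrt 2 - 1"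
proof -
  let ?p = "\<lambda>r::real. (2 - sqrt 2) * r ^ 3 - (2 + 2 * sqrt 2) * r ^ 2 + (sqrt 2 - 10) * r + 2 * sqrt 2 - 2"
  have s2: "1 < sqrt 2" by simp
  have "\<exists>x. 0 \<le> x \<and> x \<le> 1 \<and> ?p x = 0"
    by (rule IVT2') (use s2 in \<open>auto intro!: continuous_intros\<close>)
  then obtain x where x: "0 \<le> x" "x \<le> 1" "?p x = 0" by blast
  have "x \<noteq> 0" "x \<noteq> 1" using x(3) s2 by auto
  then have x01: "0 < x" "x < 1" using x by auto
  then have "(2 + x) * (1 - x\<^sup>2) \<noteq> 0" by (auto simp: power2_eq_1_iff)
  then have "right_dev x = sqrt 2 - 1"
    using right_dev_polynomial[of x] x01 x(3) by simp
  then show ?thesis using that x01 by blast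
qed

text \<open>A smaller positive root would lie in (0, \<rho>), hence in [0, 1), where
  \<open>d\<close> is strictly increasing and can take the value \<open>c\<close> only once.\<close>

lemma smallest_positive_rootI:
  fixes d p :: "real \<Rightarrow> real"
  assumes "0 < \<rho>" "\<rho> < 1" "d \<rho> = c" "\<And>r s. 0 \<le> r \<Longrightarrow> r < s \<Longrightarrow> s < 1 \<Longrightarrow> d r < d s"
    and p: "\<And>r. 0 \<le> r \<Longrightarrow> r < 1 \<Longrightarrow> p r = 0 \<longleftrightarrow> d r = c"
  shows "smallest_positive_root p \<rho>"
  unfolding smallest_positive_root_def
proof (intro conjI allI impI)
  show "0 < \<rho>" "p \<rho> = 0" using assms p[of \<rho>] by auto
  fix s assume s: "0 < s \<and> p s = 0"
  show "\<rho> \<le> s"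
  proof (rule ccontr)
    assume "\<not> \<rho> \<le> s"
    then have "d s < d \<rho>" "d s = c" using assms(4)[of s \<rho>] p[of s] s assms(2) by auto
    then show False using assms(3) by simp
  qed
qed

section \<open>From bounds on \<open>s_fun\<close> to class radii\<close>

lemma class_radius_eqI:
  assumes \<rho>: "0 < \<rho>" "\<rho> < 1"
    and dil: "\<And>f r. f \<in> F \<Longrightarrow> 0 < r \<Longrightarrow> r < \<rho> \<Longrightarrow> dilate r f \<in> G"
    and sharp: "f0 \<in> F" "\<And>r. \<rho> < r \<Longrightarrow> r < 1 \<Longrightarrow> dilate r f0 \<notin> G"
  shows "class_radius G F = \<rho>"
proof (rule antisym)
  have "radius_admissible G F \<rho>"
    using \<rho> dil by (auto simp: radius_admissible_def)
  then show "\<rho> \<le> class_radius G F" by (rule class_radius_greatest)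
  let ?R = "class_radius G F"
  have R: "radius_admissible G F ?R" by (rule class_radius_greatest)
  show "?R \<le> \<rho>"
  proof (rule ccontr)
    assume "\<not> ?R \<le> \<rho>"
    then obtain r where r: "\<rho> < r" "r < ?R" using dense[of \<rho> ?R] by auto
    then have "r < 1" "dilate r f0 \<in> G"
      using R \<rho> sharp(1) by (auto simp: radius_admissible_def)
    then show False using sharp(2) r by blast
  qed
qed

lemma dilate_class_F1:
  assumes f: "f \<in> class_F1" and r: "0 < r" "r < 1"
  shows "dilate r f \<in> class_A" "s_fun (dilate r f) holomorphic_on unit_disk"
    and "\<And>z. z \<in> unit_disk \<Longrightarrow> s_fun (dilate r f) z = s_fun f (of_real r * z)"
    and "\<And>z. z \<in> unit_disk \<Longrightarrow> norm (of_real r * z) < r"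
proof -
  have fA: "f \<in> class_A" using f class_F1_subset_class_A by blast
  then show "dilate r f \<in> class_A" using r by (intro dilate_in_class_A) auto
  show sub: "norm (of_real r * z) < r" if "z \<in> unit_disk" for z
    using that r by (simp add: norm_mult)
  show eq: "s_fun (dilate r f) z = s_fun f (of_real r * z)" if "z \<in> unit_disk" for z
    using fA sub[OF that] r by (intro s_fun_dilate) (auto simp: class_A_def)
  have "(\<lambda>z. of_real r * z) ` unit_disk \<subseteq> unit_disk"
    using less_trans[OF sub r(2)] by (auto simp: image_subset_iff)
  moreover have "(\<lambda>z. of_real r * z) holomorphic_on unit_disk"
    by (intro holomorphic_intros)
  ultimately have "(s_fun f \<circ> (\<lambda>z. of_real r * z)) holomorphic_on unit_disk"
    using s_fun_class_F1_holomorphic[OF f] by (metis holomorphic_on_compose_gen)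
  then show "s_fun (dilate r f) holomorphic_on unit_disk"
    by (rule holomorphic_transform) (simp add: eq)
qed

text \<open>Uses |2 + z| \<ge> 2 - |z|, which is an equality at z = -r, the point where the extremal
  function attains the whole bound.\<close>

lemma s_fun_class_F1_minus_1:
  assumes "f \<in> class_F1" "z \<in> unit_disk"
  shows "norm (s_fun f z - 1) \<le> left_dev (norm z)"
proof -
  have "2 - norm z \<le> norm (2 + z)"
    using norm_diff_ineq[of 2 z] by simp
  then have "norm (z / (2 + z)) \<le> norm z / (2 - norm z)"
    unfolding norm_divide using assms(2) by (intro divide_left_mono mult_pos_pos) auto
  moreover have "s_fun f z - 1 = (s_fun f z - (1 + z / (2 + z))) + z / (2 + z)"
    by simp
  then have "norm (s_fun f z - 1) \<le> norm (s_fun f z - (1 + z / (2 + z))) + norm (z / (2 + z))"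
    by (metis norm_triangle_ineq)
  ultimately show ?thesis
    using s_fun_class_F1[OF assms] by (simp add: left_dev_def)
qed

text \<open>Monotonicity of \<open>left_dev\<close> gives membership below \<rho>. Beyond \<rho> one
  omitted value is enough, whatever the shape of the region, because every such dilate of
  \<open>extremal\<close> takes the value \<alpha>.\<close>

lemma class_radius_left:
  assumes \<rho>: "0 < \<rho>" "\<rho> < 1" "left_dev \<rho> = 1 - \<alpha>"
    and G: "\<And>f. f \<in> class_A \<Longrightarrow> s_fun f holomorphic_on unit_disk \<Longrightarrow>
      (\<And>z. z \<in> unit_disk \<Longrightarrow> norm (s_fun f z - 1) < 1 - \<alpha>) \<Longrightarrow> f \<in> G"
    and omit: "\<And>f z. f \<in> G \<Longrightarrow> z \<in> unit_disk \<Longrightarrow> s_fun f z \<noteq> of_real \<alpha>"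
  shows "class_radius G class_F1 = \<rho>"
proof (rule class_radius_eqI[OF \<rho>(1,2)])
  fix f r assume f: "f \<in> class_F1" and r: "0 < r" "r < \<rho>"
  have r1: "r < 1" using r \<rho> by simp
  note d = dilate_class_F1[OF f r(1) r1]
  show "dilate r f \<in> G"
  proof (rule G[OF d(1,2)])
    fix z :: complex assume z: "z \<in> unit_disk"
    have "norm (s_fun f (of_real r * z) - 1) \<le> left_dev (norm (of_real r * z))"
      using d(4)[OF z] r1 by (intro s_fun_class_F1_minus_1 f) auto
    also have "\<dots> < left_dev \<rho>"
      using d(4)[OF z] r \<rho> by (intro left_dev_strict_mono) auto
    finally show "norm (s_fun (dilate r f) z - 1) < 1 - \<alpha>"
      using d(3)[OF z] \<rho>(3) by simp
  qed
next
  fix r assume r: "\<rho> < r" "r < 1"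
  \<comment> \<open>The dilation by \<open>r\<close> carries this point to -\<rho>, where
    \<open>s_fun extremal\<close> is \<open>1 - left_dev \<rho>\<close>, that is \<alpha>.\<close>
  let ?z = "complex_of_real (- \<rho> / r)"
  have z: "?z \<in> unit_disk" using r \<rho> by (simp add: norm_divide)
  have "s_fun (dilate r extremal) ?z = s_fun extremal (of_real (- \<rho>))"
    using dilate_class_F1(3)[OF extremal_in_class_F1 _ r(2) z] r \<rho> by simp
  also have "\<dots> = of_real (1 - left_dev \<rho>)"
    using \<rho> by (subst s_fun_extremal) (auto simp: left_dev_def algebra_simps)
  finally show "dilate r extremal \<notin> G"
    using omit[OF _ z] \<rho>(3) by auto
qed (rule extremal_in_class_F1)

text \<open>Univalence, which is part of \<open>starlike_order\<close>, comes from
  \<open>starlike_inj_on\<close>, as the real part exceeds \<alpha> \<ge> 0.\<close>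

lemma class_radius_starlike_order:
  assumes \<alpha>: "0 \<le> \<alpha>" and \<rho>: "0 < \<rho>" "\<rho> < 1" "left_dev \<rho> = 1 - \<alpha>"
  shows "class_radius (starlike_order \<alpha>) class_F1 = \<rho>"
proof (rule class_radius_left[OF \<rho>])
  fix f assume f: "f \<in> class_A" and s: "\<And>z. z \<in> unit_disk \<Longrightarrow> norm (s_fun f z - 1) < 1 - \<alpha>"
  have "Re (s_fun f z) > \<alpha>" if "z \<in> unit_disk" for z
    using s[OF that] abs_Re_le_cmod[of "s_fun f z - 1"] by simp
  then show "f \<in> starlike_order \<alpha>"
    using f \<alpha> starlike_inj_on[OF f] order.strict_trans1[OF \<alpha>]
    by (auto simp: starlike_order_def class_S_def)
next
  fix f z assume "f \<in> starlike_order \<alpha>" "z \<in> unit_disk"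
  then have "Re (s_fun f z) > \<alpha>"
    by (simp add: starlike_order_def)
  then show "s_fun f z \<noteq> of_real \<alpha>"
    by auto
qed

text \<open>With a holomorphic right inverse \<psi> of \<phi> on the disk about 1, the Schwarz
  function of the subordination is \<open>\<psi> \<circ> s_fun f\<close>. Each special class is
  thereby reduced to finding \<psi> and showing that \<phi> omits \<alpha>.\<close>

lemma class_radius_starlike_sub:
  assumes \<alpha>: "0 \<le> \<alpha>" "\<alpha> < 1"
    and \<phi>: "\<phi> holomorphic_on unit_disk" and \<psi>: "\<psi> holomorphic_on ball 1 (1 - \<alpha>)" "\<psi> 1 = 0"
    and inv: "\<And>w. w \<in> ball 1 (1 - \<alpha>) \<Longrightarrow> \<psi> w \<in> unit_disk \<and> \<phi> (\<psi> w) = w"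
    and omit: "\<And>z. z \<in> unit_disk \<Longrightarrow> \<phi> z \<noteq> of_real \<alpha>"
  shows "class_radius (starlike_sub \<phi>) class_F1 = class_radius (starlike_order \<alpha>) class_F1"
proof -
  obtain \<rho> where \<rho>: "0 < \<rho>" "\<rho> < 1" "left_dev \<rho> = 1 - \<alpha>"
    using left_dev_root[OF \<alpha>] by blast
  have "class_radius (starlike_sub \<phi>) class_F1 = \<rho>"
  proof (rule class_radius_left[OF \<rho>])
    fix f assume f: "f \<in> class_A" and hol: "s_fun f holomorphic_on unit_disk"
      and "\<And>z. z \<in> unit_disk \<Longrightarrow> norm (s_fun f z - 1) < 1 - \<alpha>"
    then have s: "s_fun f z \<in> ball 1 (1 - \<alpha>)" if "z \<in> unit_disk" for z
      using that by (simp add: dist_norm norm_minus_commute)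
    have "(\<psi> \<circ> s_fun f) holomorphic_on unit_disk"
      by (rule holomorphic_on_compose_gen[OF hol \<psi>(1)]) (use s in blast)
    moreover have "(\<psi> \<circ> s_fun f) 0 = 0" using \<psi>(2) by (simp add: s_fun_def)
    moreover have "(\<psi> \<circ> s_fun f) ` unit_disk \<subseteq> unit_disk"
      "\<forall>z\<in>unit_disk. s_fun f z = \<phi> ((\<psi> \<circ> s_fun f) z)"
      using inv s by auto
    ultimately show "f \<in> starlike_sub \<phi>"
      unfolding starlike_sub_def subordinate_def using f hol \<phi> by blast
  next
    fix f z assume f: "f \<in> starlike_sub \<phi>" and z: "z \<in> unit_disk"
    then obtain \<omega> where "\<omega> ` unit_disk \<subseteq> unit_disk" "\<forall>z\<in>unit_disk. s_fun f z = \<phi> (\<omega> z)"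
      unfolding starlike_sub_def subordinate_def by blast
    then have "\<omega> z \<in> unit_disk" "s_fun f z = \<phi> (\<omega> z)"
      using z by blast+
    then show "s_fun f z \<noteq> of_real \<alpha>"
      using omit by simp
  qed
  then show ?thesis using class_radius_starlike_order[OF \<alpha>(1) \<rho>] by simp
qed

section \<open>The exponential, cardioid, sine and lune regions\<close>

lemma one_plus_not_nonpos_Reals:
  fixes u :: complex
  assumes "norm u < 1"
  shows "1 + u \<notin> \<real>\<^sub>\<le>\<^sub>0" "Re (1 + u) > 0"
proof -
  show "Re (1 + u) > 0"
    using abs_Re_le_cmod[of u] assms by simp
  then show "1 + u \<notin> \<real>\<^sub>\<le>\<^sub>0"
    by (auto simp: complex_nonpos_Reals_iff)
qed

lemma in_ball_1_iff: "w \<in> ball 1 r \<longleftrightarrow> norm (w - 1) < r" for w :: complex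
  by (simp add: dist_norm norm_minus_commute)

text \<open>Termwise comparison of the logarithmic series. The terms at n = 0 are 0 by division by
  zero.\<close>

lemma norm_Ln_one_plus_le:
  fixes u :: complex
  assumes "norm u < 1"
  shows "norm (Ln (1 + u)) \<le> - ln (1 - norm u)"
proof -
  have 1: "(\<lambda>n. - ((- u) ^ n) / of_nat n) sums Ln (1 + u)"
    using Ln_series'[OF assms] .
  have "(\<lambda>n. - ((- (- norm u)) ^ n) / of_nat n) sums ln (1 + (- norm u))"
    using assms by (intro ln_series') simp
  then have 2: "(\<lambda>n. norm u ^ n / of_nat n) sums (- ln (1 - norm u))"
    using sums_minus by fastforce
  have "norm (\<Sum>n. - ((- u) ^ n) / of_nat n) \<le> (\<Sum>n. norm u ^ n / real n)"
    by (rule norm_suminf_le) (use 2 in \<open>auto simp: norm_divide norm_power sums_iff\<close>)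
  then show ?thesis using 1 2 by (simp add: sums_iff)
qed

lemma class_radius_starlike_e:
  "class_radius starlike_e class_F1 = class_radius (starlike_order (1 / exp 1)) class_F1"
  unfolding starlike_e_def
proof (rule class_radius_starlike_sub[where \<psi> = Ln])
  have norm1: "norm (w - 1) < 1" if "w \<in> ball 1 (1 - 1 / exp 1)" for w :: complex
    using that unfolding in_ball_1_iff by (rule less_trans) simp
  show "Ln holomorphic_on ball 1 (1 - 1 / exp 1)"
    by (rule holomorphic_on_Ln) (use one_plus_not_nonpos_Reals(1)[OF norm1] in auto)
  show "Ln w \<in> unit_disk \<and> exp (Ln w) = w" if w: "w \<in> ball 1 (1 - 1 / exp 1)" for w
  proof
    \<comment> \<open>This bound reaches 1 exactly when |w - 1| = 1 - 1/e, the radius of the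
      disk.\<close>
    have "norm (Ln (1 + (w - 1))) \<le> - ln (1 - norm (w - 1))"
      by (rule norm_Ln_one_plus_le[OF norm1[OF w]])
    also have "\<dots> < - ln (1 / exp 1)"
    proof -
      have "1 / exp 1 < 1 - norm (w - 1)" using w unfolding in_ball_1_iff by simp
      then show ?thesis using norm1[OF w] by (subst neg_less_iff_less, subst ln_less_cancel_iff) auto
    qed
    also have "\<dots> = 1" by (simp add: ln_div)
    finally show "Ln w \<in> unit_disk" by simp
    have "w \<noteq> 0" using norm1[OF w] by auto
    then show "exp (Ln w) = w" by simp
  qed
  show "exp z \<noteq> of_real (1 / exp 1)" if "z \<in> unit_disk" for z
  proof
    assume "exp z = of_real (1 / exp 1)"
    then have "exp (Re z) = exp (- 1)"
      by (metis abs_exp_cancel exp_minus inverse_eq_divide norm_exp_eq_Re norm_of_real)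
    then have "Re z = -1" by simp
    then show False using that abs_Re_le_cmod[of z] by simp
  qed
qed (auto intro!: holomorphic_intros)

text \<open>Completing the square, \<phi> z = 1/3 + 2/3 (z + 1)^2; this yields both the inverse and
  the omitted value 1/3.\<close>

lemma class_radius_starlike_C:
  "class_radius starlike_C class_F1 = class_radius (starlike_order (1 / 3)) class_F1"
  unfolding starlike_C_def
proof (rule class_radius_starlike_sub[where \<psi> = "\<lambda>w. csqrt (1 + 3 / 2 * (w - 1)) - 1"])
  have norm1: "norm (3 / 2 * (w - 1)) < 1" if "w \<in> ball 1 (1 - 1 / 3)" for w :: complex
  proof -
    have "norm (3 / 2 * (w - 1)) = 3 / 2 * norm (w - 1)"
      by (simp only: norm_mult) simp
    then show ?thesis
      using that unfolding in_ball_1_iff by simp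
  qed
  show "(\<lambda>w. csqrt (1 + 3 / 2 * (w - 1)) - 1) holomorphic_on ball 1 (1 - 1 / 3)"
    by (intro holomorphic_intros one_plus_not_nonpos_Reals norm1)
  show "csqrt (1 + 3 / 2 * (w - 1)) - 1 \<in> unit_disk \<and>
      1 + 4 / 3 * (csqrt (1 + 3 / 2 * (w - 1)) - 1) + 2 / 3 * (csqrt (1 + 3 / 2 * (w - 1)) - 1)\<^sup>2 = w"
    if w: "w \<in> ball 1 (1 - 1 / 3)" for w
  proof
    let ?s = "csqrt (1 + 3 / 2 * (w - 1))"
    have s2: "?s\<^sup>2 = 1 + 3 / 2 * (w - 1)" by (rule power2_csqrt)
    \<comment> \<open>The product is below 1 and its second factor is at least 1, since the
      principal root has nonnegative real part.\<close>
    have "norm (?s - 1) * norm (?s + 1) = norm (?s\<^sup>2 - 1)"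
      by (simp add: norm_mult[symmetric] power2_eq_square algebra_simps)
    also have "\<dots> < 1" using norm1[OF w] unfolding s2 by simp
    finally have lt: "norm (?s - 1) * norm (?s + 1) < 1" .
    have "1 \<le> Re (?s + 1)" using Re_csqrt[of "1 + 3 / 2 * (w - 1)"] by (simp del: csqrt.sel)
    also have "\<dots> \<le> norm (?s + 1)" by (rule complex_Re_le_cmod)
    finally have "norm (?s - 1) * 1 \<le> norm (?s - 1) * norm (?s + 1)"
      by (intro mult_left_mono) auto
    then show "?s - 1 \<in> unit_disk" using lt by simp
    have "1 + 4 / 3 * (?s - 1) + 2 / 3 * (?s - 1)\<^sup>2 = 1 / 3 + 2 / 3 * ?s\<^sup>2"
      by (simp add: power2_eq_square algebra_simps)
    also have "\<dots> = w"
      unfolding s2 by (simp add: field_simps)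
    finally show "1 + 4 / 3 * (?s - 1) + 2 / 3 * (?s - 1)\<^sup>2 = w" .
  qed
  show "1 + 4 / 3 * z + 2 / 3 * z\<^sup>2 \<noteq> of_real (1 / 3)" if "z \<in> unit_disk" for z
  proof
    assume "1 + 4 / 3 * z + 2 / 3 * z\<^sup>2 = of_real (1 / 3)"
    moreover have "(z + 1)\<^sup>2 = 3 / 2 * ((1 + 4 / 3 * z + 2 / 3 * z\<^sup>2) - 1 / 3)"
      by (simp add: power2_eq_square field_simps)
    ultimately have "(z + 1)\<^sup>2 = 0" by simp
    then have "z = -1" by (simp add: add_eq_0_iff2)
    then show False using that by simp
  qed
qed (auto intro!: holomorphic_intros)

lemma sin_ge_chord:
  fixes x :: real
  assumes "0 \<le> x" "x \<le> 1"
  shows "x * sin 1 \<le> sin x"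
proof -
  have "concave_on {0..1} (sin :: real \<Rightarrow> real)"
  proof (rule f''_le0_imp_concave)
    show "(sin has_real_derivative cos x) (at x)" for x :: real by (rule DERIV_sin)
    show "(cos has_real_derivative - sin x) (at x)" for x :: real by (rule DERIV_cos)
    show "- sin x \<le> 0" if "x \<in> {0..1}" for x :: real
      using that pi_ge_two by (auto intro!: sin_ge_zero)
  qed simp
  from concave_onD[OF this assms, of 0 1] show ?thesis by simp
qed

text \<open>This is y \<le> sinh y: the difference has derivative (exp (x/2) - exp
  (-x/2))^2.\<close>

lemma exp_diff_ge:
  fixes y :: real
  assumes "0 \<le> y"
  shows "2 * y \<le> exp y - exp (- y)"
proof -
  let ?g = "\<lambda>y::real. exp y - exp (- y) - 2 * y"
  have "?g 0 \<le> ?g y"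
  proof (rule DERIV_nonneg_imp_nondecreasing[OF assms])
    fix x :: real
    have "(?g has_real_derivative exp x + exp (- x) - 2) (at x)"
      by (auto intro!: derivative_eq_intros)
    moreover have "0 \<le> (exp (x / 2) - exp (- x / 2))\<^sup>2" by simp
    then have "0 \<le> exp x + exp (- x) - 2"
      by (simp add: power2_eq_square algebra_simps flip: exp_add)
    ultimately show "\<exists>d. (?g has_real_derivative d) (at x) \<and> 0 \<le> d" by blast
  qed
  then show ?thesis by simp
qed

text \<open>From |sin z|^2 = (sin x)^2 + (sinh y)^2 and |sinh y| \<ge> |y|, for z = x + iy.\<close>

lemma norm_sin_squared_ge: "(sin (Re z))\<^sup>2 + (Im z)\<^sup>2 \<le> (norm (sin z))\<^sup>2"
proof -
  let ?y = "Im z"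
  have "(2 * \<bar>?y\<bar>)\<^sup>2 \<le> (exp \<bar>?y\<bar> - exp (- \<bar>?y\<bar>))\<^sup>2"
    by (intro power_mono exp_diff_ge) auto
  also have "\<dots> = exp (2 * ?y) + inverse (exp (2 * ?y)) - 2"
    by (cases "?y \<ge> 0") (simp_all add: power2_eq_square algebra_simps flip: exp_add exp_minus)
  finally have "4 * ?y\<^sup>2 \<le> exp (2 * ?y) + inverse (exp (2 * ?y)) - 2"
    by (simp add: power_mult_distrib)
  then show ?thesis
    unfolding norm_sin_squared cos_double_sin[of "Re z"] by simp
qed

text \<open>Suppose x^2 + y^2 \<ge> 1. If |x| \<ge> 1, monotonicity of sin suffices. Otherwise the
  chord bound gives (sin x)^2 + y^2 \<ge> x^2 (sin 1)^2 + 1 - x^2 \<ge> (sin 1)^2.\<close>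

lemma norm_less_1_if_norm_sin_less:
  assumes re: "\<bar>Re z\<bar> < pi / 2" and lt: "norm (sin z) < sin 1"
  shows "norm z < 1"
proof (rule ccontr)
  assume "\<not> norm z < 1"
  then have "1 \<le> (norm z)\<^sup>2" by simp
  then have n: "1 \<le> (Re z)\<^sup>2 + (Im z)\<^sup>2" by (simp only: cmod_power2)
  have s1: "0 < sin (1::real)" using pi_ge_two by (intro sin_gt_zero) (auto intro: less_le_trans[of _ 2])
  have "(norm (sin z))\<^sup>2 < (sin 1)\<^sup>2" using lt by (intro power_strict_mono) auto
  then have ub: "(sin (Re z))\<^sup>2 + (Im z)\<^sup>2 < (sin 1)\<^sup>2" using norm_sin_squared_ge[of z] by linarith
  have absq: "(sin (Re z))\<^sup>2 = (sin \<bar>Re z\<bar>)\<^sup>2" by (simp add: abs_if)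
  show False
  proof (cases "1 \<le> \<bar>Re z\<bar>")
    case True
    then have "sin 1 \<le> sin \<bar>Re z\<bar>" using re by (intro sin_monotone_2pi_le) auto
    then have "(sin 1)\<^sup>2 \<le> (sin \<bar>Re z\<bar>)\<^sup>2" using s1 by (intro power_mono) auto
    then show False using ub absq by (smt (verit) zero_le_power2)
  next
    case False
    then have "\<bar>Re z\<bar> * sin 1 \<le> sin \<bar>Re z\<bar>" by (intro sin_ge_chord) auto
    then have "(\<bar>Re z\<bar> * sin 1)\<^sup>2 \<le> (sin \<bar>Re z\<bar>)\<^sup>2" using s1 by (intro power_mono) auto
    then have a: "(Re z)\<^sup>2 * (sin 1)\<^sup>2 \<le> (sin (Re z))\<^sup>2" using absq by (simp add: power_mult_distrib)
    have "(Re z)\<^sup>2 \<le> 1" using False by (simp add: abs_square_le_1)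
    then have "(1 - (Re z)\<^sup>2) * (sin 1)\<^sup>2 \<le> (1 - (Re z)\<^sup>2) * 1"
      by (intro mult_left_mono) (auto simp: abs_square_le_1)
    then have "(sin 1)\<^sup>2 \<le> (Re z)\<^sup>2 * (sin 1)\<^sup>2 + (1 - (Re z)\<^sup>2)"
      by (simp add: algebra_simps)
    then show False using a ub n by linarith
  qed
qed

lemma class_radius_starlike_sin:
  "class_radius starlike_sin class_F1 = class_radius (starlike_order (1 - sin 1)) class_F1"
  unfolding starlike_sin_def
proof (rule class_radius_starlike_sub[where \<psi> = "\<lambda>w. Arcsin (w - 1)"])
  have s01: "0 < sin (1::real)" using pi_ge_two by (intro sin_gt_zero) (auto intro: less_le_trans[of _ 2])
  then show "1 - sin 1 < (1::real)" by simp
  show "0 \<le> 1 - sin (1::real)" by simp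
  have s1: "norm (w - 1) < sin 1" "\<bar>Re (w - 1)\<bar> < 1" if "w \<in> ball 1 (1 - (1 - sin 1))" for w :: complex
  proof -
    show "norm (w - 1) < sin 1" using that by (simp only: in_ball_1_iff)
    then show "\<bar>Re (w - 1)\<bar> < 1" using abs_Re_le_cmod[of "w - 1"] sin_le_one[of "1::real"] by linarith
  qed
  have "(Arcsin \<circ> (\<lambda>w. w - 1)) holomorphic_on ball 1 (1 - (1 - sin 1))"
    by (intro holomorphic_on_compose holomorphic_on_Arcsin holomorphic_intros) (use s1 in force)
  then show "(\<lambda>w. Arcsin (w - 1)) holomorphic_on ball 1 (1 - (1 - sin 1))"
    by (simp add: o_def)
  show "Arcsin (w - 1) \<in> unit_disk \<and> 1 + sin (Arcsin (w - 1)) = w"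
    if w: "w \<in> ball 1 (1 - (1 - sin 1))" for w
    using norm_less_1_if_norm_sin_less[of "Arcsin (w - 1)"] Arcsin_bounds[of "w - 1"] s1[OF w] by simp
  show "1 + sin z \<noteq> of_real (1 - sin 1)" if z: "z \<in> unit_disk" for z
  proof
    assume "1 + sin z = of_real (1 - sin 1)"
    then have sz: "sin z = of_real (- sin 1)" by (simp add: algebra_simps add_eq_0_iff2)
    have x: "\<bar>Re z\<bar> < 1" using z abs_Re_le_cmod[of z] by simp
    have "cos (Re z) > 0" using x pi_ge_two by (intro cos_gt_zero_pi) auto
    moreover have "Im (sin z) = 0" unfolding sz by simp
    \<comment> \<open>Im (sin z) is cos x sinh y, so a real value of the sine forces y = 0 when cos
      x > 0.\<close>
    ultimately have "exp (Im z) = exp (- Im z)" by (simp add: Im_sin)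
    then have y: "Im z = 0" by simp
    have "sin (Re z) = sin (- 1)"
      using arg_cong[OF sz, of Re] y by (simp add: Re_sin)
    moreover have "- (pi / 2) \<le> Re z" "Re z \<le> pi / 2" "- (pi / 2) \<le> - 1" "- 1 \<le> pi / 2"
      using x pi_ge_two by linarith+
    ultimately have "Re z = -1"
      by (metis sin_inj_pi)
    then show False using x by simp
  qed
qed (auto intro!: holomorphic_intros)

text \<open>Squaring w - z = sqrt (1 + z^2) gives w^2 - 2wz = 1, hence the inverse (w^2 -
  1)/(2w).\<close>

lemma class_radius_starlike_lune:
  "class_radius starlike_lune class_F1 = class_radius (starlike_order (sqrt 2 - 1)) class_F1"
  unfolding starlike_lune_def
proof (rule class_radius_starlike_sub[where \<psi> = "\<lambda>w. (w\<^sup>2 - 1) / (2 * w)"])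
  show "0 \<le> sqrt 2 - 1" "sqrt 2 - 1 < 1" by (auto simp: sqrt2_less_2)
  have n: "norm (w - 1) < 2 - sqrt 2" "Re w > 0" if "w \<in> ball 1 (1 - (sqrt 2 - 1))" for w :: complex
  proof -
    show n: "norm (w - 1) < 2 - sqrt 2" using that by (simp only: in_ball_1_iff)
    have "1 < sqrt 2" by simp
    then have "norm (w - 1) < 1" using n by linarith
    then show "Re w > 0" using one_plus_not_nonpos_Reals(2)[of "w - 1"] by simp
  qed
  have "w \<noteq> 0" if "w \<in> ball 1 (1 - (sqrt 2 - 1))" for w :: complex
    using n(2)[OF that] by auto
  then show "(\<lambda>w. (w\<^sup>2 - 1) / (2 * w)) holomorphic_on ball 1 (1 - (sqrt 2 - 1))"
    by (auto intro!: holomorphic_intros)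
  have "norm (z\<^sup>2) < 1" if "z \<in> unit_disk" for z :: complex
    using that by (simp add: norm_power abs_square_less_1)
  then show "(\<lambda>z. z + csqrt (1 + z\<^sup>2)) holomorphic_on unit_disk"
    by (intro holomorphic_intros one_plus_not_nonpos_Reals)
  show "(w\<^sup>2 - 1) / (2 * w) \<in> unit_disk \<and>
      (w\<^sup>2 - 1) / (2 * w) + csqrt (1 + ((w\<^sup>2 - 1) / (2 * w))\<^sup>2) = w"
    if w: "w \<in> ball 1 (1 - (sqrt 2 - 1))" for w
  proof
    have w0: "w \<noteq> 0" using n(2)[OF w] by auto
    let ?\<rho> = "norm (w - 1)" and ?m = "norm w"
    have "sqrt 2 * sqrt 2 = 2" by simp
    \<comment> \<open>Says (2 - \<rho>)^2 > 2, which rearranges to the next inequality; here \<rho>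
      is |w - 1|.\<close>
    moreover have "0 < (2 - ?\<rho> - sqrt 2) * (2 - ?\<rho> + sqrt 2)"
      using n[OF w] real_sqrt_gt_zero[of 2] by (intro mult_pos_pos) (linarith | simp)+
    ultimately have q: "?\<rho> < (1 - ?\<rho>) * (2 - ?\<rho>)"
      by (simp add: algebra_simps)
    have m: "1 - ?\<rho> \<le> ?m" using norm_triangle_ineq2[of 1 "1 - w"] by (simp add: norm_minus_commute)
    have r2: "?\<rho> < 2" using n(1)[OF w] real_sqrt_gt_zero[of 2] by linarith
    have "(1 - ?\<rho>) * (2 - ?\<rho>) \<le> ?m * (2 - ?\<rho>)"
      using m r2 by (intro mult_right_mono) auto
    then have q2: "?\<rho> * (1 + ?m) < 2 * ?m" using q by (simp add: algebra_simps)
    have "norm (w\<^sup>2 - 1) = ?\<rho> * norm (1 + w)"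
      by (simp add: norm_mult[symmetric] power2_eq_square algebra_simps)
    also have "\<dots> \<le> ?\<rho> * (1 + ?m)"
      using norm_triangle_ineq[of 1 w] by (intro mult_left_mono) auto
    also note q2
    finally show "(w\<^sup>2 - 1) / (2 * w) \<in> unit_disk"
      using w0 by (simp add: norm_divide norm_mult)
    have eq: "1 + ((w\<^sup>2 - 1) / (2 * w))\<^sup>2 = ((w + inverse w) / 2)\<^sup>2"
      using w0 by (simp add: field_simps power2_eq_square)
    \<comment> \<open>The positive real part selects (w + 1/w)/2 as the principal square
      root.\<close>
    have "0 < Re ((w + inverse w) / 2)"
      using n(2)[OF w] by (auto intro!: add_pos_nonneg divide_nonneg_nonneg)
    then have "csqrt (1 + ((w\<^sup>2 - 1) / (2 * w))\<^sup>2) = (w + inverse w) / 2"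
      unfolding eq by (intro csqrt_square) auto
    then show "(w\<^sup>2 - 1) / (2 * w) + csqrt (1 + ((w\<^sup>2 - 1) / (2 * w))\<^sup>2) = w"
      using w0 by (simp add: field_simps power2_eq_square)
  qed
  show "z + csqrt (1 + z\<^sup>2) \<noteq> of_real (sqrt 2 - 1)" if "z \<in> unit_disk" for z
  proof
    define w where "w = complex_of_real (sqrt 2 - 1)"
    assume "z + csqrt (1 + z\<^sup>2) = of_real (sqrt 2 - 1)"
    then have "csqrt (1 + z\<^sup>2) = w - z" by (simp add: w_def algebra_simps)
    then have "1 + z\<^sup>2 = (w - z)\<^sup>2" by (metis power2_csqrt)
    then have "1 - w\<^sup>2 = - 2 * w * z" by (simp add: power2_eq_square algebra_simps)
    moreover have "1 - (sqrt 2 - 1)\<^sup>2 = 2 * (sqrt 2 - 1)"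
      by (simp add: power2_eq_square algebra_simps)
    then have "complex_of_real (1 - (sqrt 2 - 1)\<^sup>2) = of_real (2 * (sqrt 2 - 1))"
      by (simp only:)
    then have "1 - w\<^sup>2 = 2 * w"
      by (simp only: w_def of_real_diff of_real_mult of_real_power of_real_1 of_real_numeral)
    ultimately have "w * (z + 1) = 0" by algebra
    moreover have "w \<noteq> 0" by (simp add: w_def)
    ultimately have "z = -1" by (simp add: add_eq_0_iff2)
    then show False using that by simp
  qed
qed auto

section \<open>The rational and parabolic regions\<close>

text \<open>The inverse of the defining function picks, of the two roots of
  \<open>z\<^sup>2 + k * w * z + k\<^sup>2 * (1 - w)\<close>, the one of smaller modulus; it lies in the disk because
  the product of the roots does.\<close>

lemma class_radius_starlike_R:
  "class_radius starlike_R class_F1 = class_radius (starlike_order (2 * (sqrt 2 - 1))) class_F1"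
proof -
  define k where "k = complex_of_real (sqrt 2 + 1)"
  define B where "B = ball (1::complex) (1 - 2 * (sqrt 2 - 1))"
  have nk: "norm k = sqrt 2 + 1"
    unfolding k_def norm_of_real by simp
  then have "0 < norm k"
    by (simp add: add_pos_pos)
  then have k0: "k \<noteq> 0"
    by simp
  have s2: "1.4 < sqrt (2::real)" "sqrt (2::real) < 1.5"
    by (rule real_less_rsqrt, simp add: power2_eq_square)
       (rule real_less_lsqrt, simp_all add: power2_eq_square)
  have kz: "k\<^sup>2 - k * z \<noteq> 0" if "z \<in> unit_disk" for z
  proof -
    have "k \<noteq> z" using that nk s2 by auto
    then show ?thesis using k0 by (simp add: power2_eq_square flip: right_diff_distrib)
  qed
  have n: "norm (w - 1) < 1 - 2 * (sqrt 2 - 1)" if "w \<in> B" for w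
    using that unfolding B_def by (simp only: in_ball_1_iff)
  have n2: "norm (w - 1) < 1 / 5" if "w \<in> B" for w
    using n[OF that] s2(1) by simp
  have small: "Re (1 + (6 * (w - 1) + (w - 1)\<^sup>2)) > 0" if w: "w \<in> B" for w
  proof -
    define u where "u = w - 1"
    let ?\<rho> = "norm u" and ?x = "Re u"
    have \<rho>: "?\<rho> < 3 - 2 * sqrt 2" using n[OF w] by (simp add: u_def)
    have x: "- ?\<rho> \<le> ?x" "?\<rho> \<le> 1 / 5"
      using abs_Re_le_cmod[of u] n2[OF w] by (auto simp: u_def)
    \<comment> \<open>For |u| = \<rho> the real part of 1 + 6u + u^2 is least at u = -\<rho>, where
      it is (3 - \<rho>)^2 - 8; this is positive for \<rho> below 3 - 2 sqrt 2, the radius of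
      \<open>B\<close>.\<close>
    have "(2 * sqrt 2)\<^sup>2 < (3 - ?\<rho>)\<^sup>2"
      using \<rho> by (intro power_strict_mono) auto
    then have "0 < 1 - 6 * ?\<rho> + ?\<rho>\<^sup>2"
      by (simp add: power2_eq_square algebra_simps)
    also have "\<dots> \<le> 1 + 6 * ?x + 2 * ?x\<^sup>2 - ?\<rho>\<^sup>2"
    proof -
      have "0 \<le> (?x + ?\<rho>) * (6 + 2 * (?x - ?\<rho>))"
        using x by (intro mult_nonneg_nonneg) auto
      then show ?thesis by (simp add: power2_eq_square algebra_simps)
    qed
    also have "\<dots> = Re (1 + (6 * u + u\<^sup>2))"
      by (simp only: cmod_power2) (simp add: power2_eq_square algebra_simps)
    finally show ?thesis by (simp only: u_def)
  qed
  \<comment> \<open>The radicand is w^2 + 4(w - 1), the discriminant of the quadratic divided by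
    k^2, so the roots are k/2 times -w + S w and -w - S w.\<close>
  define S where "S = (\<lambda>w. csqrt (1 + (6 * (w - 1) + (w - 1)\<^sup>2)))"
  have S: "(S w - w) * (S w + w) = 4 * (w - 1)" for w
  proof -
    have "(S w)\<^sup>2 = 1 + (6 * (w - 1) + (w - 1)\<^sup>2)" by (simp only: S_def power2_csqrt)
    then show ?thesis by (simp add: power2_eq_square algebra_simps)
  qed
  \<comment> \<open>Both \<open>S w\<close> and \<open>w\<close> lie in the sector |Im| \<le> Re, so
    their real inner product is nonnegative.\<close>
  have le: "norm (S w - w) \<le> norm (S w + w)" if w: "w \<in> B" for w
  proof -
    have "0 < Re ((S w)\<^sup>2)" using small[OF w] by (simp only: S_def power2_csqrt)
    then have "(Im (S w))\<^sup>2 \<le> (Re (S w))\<^sup>2" by (simp add: power2_eq_square)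
    moreover have a: "0 \<le> Re (S w)" unfolding S_def by (rule Re_csqrt)
    ultimately have b: "\<bar>Im (S w)\<bar> \<le> Re (S w)" by (metis abs_le_square_iff abs_of_nonneg)
    have "\<bar>Re (w - 1)\<bar> < 1 / 5" "\<bar>Im (w - 1)\<bar> < 1 / 5"
      using abs_Re_le_cmod[of "w - 1"] abs_Im_le_cmod[of "w - 1"] n2[OF w] by linarith+
    then have c: "4 / 5 \<le> Re w" "\<bar>Im w\<bar> \<le> 4 / 5"
      unfolding minus_complex.sel one_complex.sel by linarith+
    have "\<bar>Im (S w) * Im w\<bar> \<le> Re (S w) * (4 / 5)"
      unfolding abs_mult using b c by (intro mult_mono) auto
    also have "\<dots> \<le> Re (S w) * Re w" using a c by (intro mult_left_mono) auto
    finally have "0 \<le> Re (S w) * Re w + Im (S w) * Im w" by linarith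
    moreover have "(norm (S w + w))\<^sup>2 - (norm (S w - w))\<^sup>2 = 4 * (Re (S w) * Re w + Im (S w) * Im w)"
      by (simp only: cmod_power2) (simp add: power2_eq_square algebra_simps)
    ultimately have "0 \<le> (norm (S w + w))\<^sup>2 - (norm (S w - w))\<^sup>2" by simp
    then have "(norm (S w - w))\<^sup>2 \<le> (norm (S w + w))\<^sup>2" by simp
    then show ?thesis by (rule power2_le_imp_le) simp
  qed
  have "class_radius (starlike_sub (\<lambda>z. 1 + (k * z + z\<^sup>2) / (k\<^sup>2 - k * z))) class_F1
      = class_radius (starlike_order (2 * (sqrt 2 - 1))) class_F1"
  proof (rule class_radius_starlike_sub[where \<alpha> = "2 * (sqrt 2 - 1)" and \<psi> = "\<lambda>w. k / 2 * (S w - w)", folded B_def])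
    show "0 \<le> 2 * (sqrt 2 - 1)" "2 * (sqrt 2 - 1) < 1" using s2 by auto
    show "(\<lambda>z. 1 + (k * z + z\<^sup>2) / (k\<^sup>2 - k * z)) holomorphic_on unit_disk"
      using kz by (auto intro!: holomorphic_intros)
    have "1 + (6 * (w - 1) + (w - 1)\<^sup>2) \<notin> \<real>\<^sub>\<le>\<^sub>0" if "w \<in> B" for w
      using small[OF that] unfolding complex_nonpos_Reals_iff by linarith
    then show "(\<lambda>w. k / 2 * (S w - w)) holomorphic_on B"
      unfolding S_def by (intro holomorphic_intros)
    show "k / 2 * (S 1 - 1) = 0" by (simp add: S_def)
    show "k / 2 * (S w - w) \<in> unit_disk \<and>
        1 + (k * (k / 2 * (S w - w)) + (k / 2 * (S w - w))\<^sup>2) / (k\<^sup>2 - k * (k / 2 * (S w - w))) = w"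
      if w: "w \<in> B" for w
    proof
      define t where "t = S w - w"
      \<comment> \<open>The chain ends at 4(3 - 2 sqrt 2) = (2(sqrt 2 - 1))^2, and |k|/2 times
        2(sqrt 2 - 1) is exactly 1.\<close>
      have "(norm t)\<^sup>2 \<le> norm t * norm (S w + w)"
        unfolding t_def power2_eq_square by (intro mult_left_mono le[OF w]) auto
      also have "\<dots> = norm (4 * (w - 1))" by (simp only: t_def norm_mult[symmetric] S)
      also have "\<dots> < 4 * (1 - 2 * (sqrt 2 - 1))" using n[OF w] by (simp only: norm_mult) simp
      also have "\<dots> = (2 * (sqrt 2 - 1))\<^sup>2" by (simp add: power2_eq_square algebra_simps)
      finally have "norm t < 2 * (sqrt 2 - 1)" using s2 by (rule_tac power2_less_imp_less) auto
      then have "(sqrt 2 + 1) / 2 * norm t < (sqrt 2 + 1) / 2 * (2 * (sqrt 2 - 1))"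
        using s2 by (intro mult_strict_left_mono) auto
      moreover have "norm (k / 2 * t) = (sqrt 2 + 1) / 2 * norm t"
        by (simp only: norm_mult norm_divide nk) simp
      ultimately have "norm (k / 2 * t) < (sqrt 2 + 1) / 2 * (2 * (sqrt 2 - 1))" by simp
      also have "\<dots> = 1" by (simp add: algebra_simps)
      finally show in_disk: "k / 2 * (S w - w) \<in> unit_disk" by (simp add: t_def)
      have "t + 2 * w = S w + w" by (simp add: t_def)
      then have "t * (t + 2 * w) = 4 * (w - 1)" using S[of w] by (simp only: t_def)
      then have "k * (k / 2 * t) + (k / 2 * t)\<^sup>2 = (w - 1) * (k\<^sup>2 - k * (k / 2 * t))"
        by (simp add: field_simps) algebra
      then show "1 + (k * (k / 2 * (S w - w)) + (k / 2 * (S w - w))\<^sup>2) / (k\<^sup>2 - k * (k / 2 * (S w - w))) = w"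
        using kz[OF in_disk] unfolding t_def[symmetric] by simp
    qed
    show "1 + (k * z + z\<^sup>2) / (k\<^sup>2 - k * z) \<noteq> of_real (2 * (sqrt 2 - 1))" if z: "z \<in> unit_disk" for z
    proof
      define a where "a = complex_of_real (2 * (sqrt 2 - 1))"
      assume "1 + (k * z + z\<^sup>2) / (k\<^sup>2 - k * z) = of_real (2 * (sqrt 2 - 1))"
      then have "k * z + z\<^sup>2 = (a - 1) * (k\<^sup>2 - k * z)"
        using kz[OF z] by (simp add: a_def field_simps)
      \<comment> \<open>For w = a the quadratic becomes z^2 + 2z + 1, because a k = 2 and k^2 - 2k =
        1.\<close>
      moreover have "2 * (sqrt 2 - 1) * (sqrt 2 + 1) = 2"
        by (simp add: algebra_simps)
      then have "complex_of_real (2 * (sqrt 2 - 1) * (sqrt 2 + 1)) = of_real 2"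
        by (simp only:)
      then have "a * k = 2"
        by (simp only: a_def k_def of_real_mult of_real_numeral)
      moreover have "(sqrt 2 + 1)\<^sup>2 = 2 * (sqrt 2 + 1) + 1"
        by (simp add: power2_eq_square algebra_simps)
      then have "complex_of_real ((sqrt 2 + 1)\<^sup>2) = of_real (2 * (sqrt 2 + 1) + 1)"
        by (simp only:)
      then have "k\<^sup>2 = 2 * k + 1"
        by (simp only: k_def of_real_add of_real_mult of_real_power of_real_1 of_real_numeral)
      ultimately have "(z + 1)\<^sup>2 = 0" by algebra
      then have "z = -1" by (simp add: add_eq_0_iff2)
      then show False using z by simp
    qed
  qed
  then show ?thesis unfolding starlike_R_def k_def Let_def .
qed

text \<open>Off the negative axis \<open>csqrt z\<close> is a holomorphic root, off the positive
  axis \<open>\<i> * csqrt (- z)\<close> is one, and an even function does not distinguish them. The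
  remaining point 0 is removable by continuity.\<close>

lemma even_comp_csqrt_holomorphic:
  assumes E: "E holomorphic_on ball 0 r" and even: "\<And>z. z \<in> ball 0 r \<Longrightarrow> E (- z) = E z"
    and r: "0 < r"
  shows "(\<lambda>z. E (csqrt z)) holomorphic_on ball 0 (r\<^sup>2)"
proof (rule no_isolated_singularity[where K = "{0}"])
  have sqrt_in: "csqrt z \<in> ball 0 r" if "z \<in> ball 0 (r\<^sup>2)" for z
    using that r by (simp add: real_less_lsqrt del: csqrt.sel)
  let ?A = "ball 0 (r\<^sup>2) - \<real>\<^sub>\<le>\<^sub>0" and ?B = "ball 0 (r\<^sup>2) - \<real>\<^sub>\<ge>\<^sub>0 :: complex set"
  have "(E \<circ> csqrt) holomorphic_on ?A"
    by (rule holomorphic_on_compose_gen[OF _ E]) (use sqrt_in in \<open>auto intro!: holomorphic_intros\<close>)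
  then have A: "(\<lambda>z. E (csqrt z)) holomorphic_on ?A" by (simp add: o_def)
  have iB: "(E \<circ> (\<lambda>z. \<i> * csqrt (- z))) holomorphic_on ?B"
  proof (rule holomorphic_on_compose_gen[OF _ E])
    show "(\<lambda>z. \<i> * csqrt (- z)) holomorphic_on ?B"
      by (intro holomorphic_intros) (auto simp: complex_nonpos_Reals_iff complex_nonneg_Reals_iff)
    show "(\<lambda>z. \<i> * csqrt (- z)) ` ?B \<subseteq> ball 0 r"
      using r by (auto simp: norm_mult real_less_lsqrt)
  qed
  have eq: "E (\<i> * csqrt (- z)) = E (csqrt z)" if "z \<in> ball 0 (r\<^sup>2)" for z
  proof -
    have "(\<i> * csqrt (- z))\<^sup>2 = (csqrt z)\<^sup>2" by (simp add: power_mult_distrib)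
    then have "\<i> * csqrt (- z) = csqrt z \<or> \<i> * csqrt (- z) = - csqrt z"
      by (simp only: power2_eq_iff)
    then show ?thesis using even[OF sqrt_in[OF that]] by auto
  qed
  have B: "(\<lambda>z. E (csqrt z)) holomorphic_on ?B"
    by (rule holomorphic_transform[OF iB]) (use eq in auto)
  have "(\<lambda>z. E (csqrt z)) holomorphic_on ?A \<union> ?B"
    by (rule holomorphic_on_Un[OF A B]) auto
  moreover have "?A \<union> ?B = ball 0 (r\<^sup>2) - {0}"
    using r by (auto simp: complex_nonpos_Reals_iff complex_nonneg_Reals_iff complex_eq_iff)
  ultimately show hol: "(\<lambda>z. E (csqrt z)) holomorphic_on ball 0 (r\<^sup>2) - {0}" by simp
  show "continuous_on (ball 0 (r\<^sup>2)) (\<lambda>z. E (csqrt z))"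
  proof (rule continuous_at_imp_continuous_on, rule ballI)
    fix z :: complex assume z: "z \<in> ball 0 (r\<^sup>2)"
    show "isCont (\<lambda>z. E (csqrt z)) z"
    proof (cases "z = 0")
      case False
      then show ?thesis
        using holomorphic_on_imp_continuous_on[OF hol] z
        by (simp add: continuous_on_eq_continuous_at open_delete)
    next
      case True
      have "((\<lambda>z. norm (csqrt z)) \<longlongrightarrow> sqrt (norm (0::complex))) (at 0)"
        unfolding norm_csqrt by (intro tendsto_intros)
      then have "((\<lambda>z. norm (csqrt z)) \<longlongrightarrow> 0) (at 0)" by simp
      then have "(csqrt \<longlongrightarrow> 0) (at 0)" by (rule tendsto_norm_zero_cancel)
      then have "isCont csqrt 0" by (simp add: isCont_def)
      moreover have "isCont E (csqrt 0)"
        using holomorphic_on_imp_continuous_on[OF E] r by (simp add: continuous_on_eq_continuous_at)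
      ultimately show ?thesis using True isCont_o2 by blast
    qed
  qed
qed auto

text \<open>\<open>T v\<close> is tanh (pi v/2), chosen so that E (T v) = 1 + 2 v^2. Solving for v
  gives csqrt ((w - 1)/2), and |w - 1| < 1/2 means |v| < 1/2, which keeps exp (pi v) in the right
  half-plane. Since \<open>E\<close> and T^2 are even, the branch cut of \<open>csqrt\<close> does
  no harm.\<close>

lemma class_radius_starlike_P:
  "class_radius starlike_P class_F1 = class_radius (starlike_order (1 / 2)) class_F1"
proof -
  define E where "E = (\<lambda>z::complex. 1 + of_real (2 / pi\<^sup>2) * (Ln ((1 + z) / (1 - z)))\<^sup>2)"
  define T where "T = (\<lambda>v::complex. (exp (of_real pi * v) - 1) / (exp (of_real pi * v) + 1))"
  have H: "(1 + z) / (1 - z) \<notin> \<real>\<^sub>\<le>\<^sub>0" if "z \<in> unit_disk" for z :: complex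
    using Re_half_plane_map_pos[of z] that unfolding complex_nonpos_Reals_iff by fastforce
  have Ehol: "E holomorphic_on ball 0 1"
    unfolding E_def by (intro holomorphic_intros H half_plane_map_holomorphic) auto
  have Eeven: "E (- z) = E z" if "z \<in> ball 0 1" for z
  proof -
    have "(1 + - z) / (1 - - z) = inverse ((1 + z) / (1 - z))" by simp
    then have "Ln ((1 + - z) / (1 - - z)) = - Ln ((1 + z) / (1 - z))"
      using Ln_inverse[OF H[OF that]] by (simp only:)
    then show ?thesis by (simp add: E_def)
  qed
  have E1: "(\<lambda>z. E (csqrt z)) holomorphic_on unit_disk"
    using even_comp_csqrt_holomorphic[OF Ehol Eeven] by simp
  have Re_exp_pos: "Re (exp (of_real pi * v)) > 0" if "v \<in> ball 0 (1 / 2)" for v :: complex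
  proof -
    have "pi * \<bar>Im v\<bar> < pi * (1 / 2)"
      using abs_Im_le_cmod[of v] that by (intro mult_strict_left_mono) auto
    then have "\<bar>pi * Im v\<bar> < pi / 2" by (simp add: abs_mult)
    then have "- (pi / 2) < pi * Im v" "pi * Im v < pi / 2" by linarith+
    then have "0 < cos (pi * Im v)" by (rule cos_gt_zero_pi)
    then show ?thesis by (simp add: Re_exp)
  qed
  have den: "exp (of_real pi * v) + 1 \<noteq> 0" if "v \<in> ball 0 (1 / 2)" for v :: complex
    using Re_exp_pos[OF that] by (auto simp: complex_eq_iff)
  have Thol: "(\<lambda>v. (T v)\<^sup>2) holomorphic_on ball 0 (1 / 2)"
    unfolding T_def using den by (intro holomorphic_intros)
  have Teven: "(T (- v))\<^sup>2 = (T v)\<^sup>2" if "v \<in> ball 0 (1 / 2)" for v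
  proof -
    define e where "e = exp (of_real pi * v)"
    have e: "e \<noteq> 0" by (simp add: e_def)
    have "T (- v) = (inverse e - 1) / (inverse e + 1)"
      by (simp add: T_def e_def exp_minus)
    also have "\<dots> = ((1 - e) / e) / ((e + 1) / e)"
    proof -
      have "inverse e - 1 = (1 - e) / e" "inverse e + 1 = (e + 1) / e"
        using e by (simp_all add: field_simps)
      then show ?thesis by (simp only:)
    qed
    also have "\<dots> = (1 - e) / (e + 1)"
      using e by simp
    also have "\<dots> = - T v"
      unfolding T_def e_def[symmetric] by (metis minus_diff_eq minus_divide_left)
    finally show ?thesis by simp
  qed
  have T1: "norm (T v) < 1" if v: "v \<in> ball 0 (1 / 2)" for v
  proof -
    let ?e = "exp (of_real pi * v)"
    have "(norm (?e + 1))\<^sup>2 - (norm (?e - 1))\<^sup>2 = 4 * Re ?e"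
      by (simp only: cmod_power2) (simp add: power2_eq_square algebra_simps)
    then have "(norm (?e - 1))\<^sup>2 < (norm (?e + 1))\<^sup>2" using Re_exp_pos[OF v] by linarith
    then have "norm (?e - 1) < norm (?e + 1)" by (rule power2_less_imp_less) simp
    then show ?thesis using den[OF v] by (simp add: T_def norm_divide)
  qed
  have ET: "E (T v) = 1 + 2 * v\<^sup>2" if v: "v \<in> ball 0 (1 / 2)" for v
  proof -
    let ?e = "exp (of_real pi * v)"
    have "(1 + T v) / (1 - T v) = ?e"
      using den[OF v] by (simp add: T_def divide_simps)
    moreover have "\<bar>Im (of_real pi * v)\<bar> < pi"
    proof -
      have "pi * \<bar>Im v\<bar> < pi * 1"
        using abs_Im_le_cmod[of v] v by (intro mult_strict_left_mono) auto
      then show ?thesis by (simp add: abs_mult)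
    qed
    then have "- pi < Im (of_real pi * v)" "Im (of_real pi * v) \<le> pi" by linarith+
    then have "Ln ?e = of_real pi * v" by (rule Ln_exp)
    ultimately show ?thesis by (simp add: E_def power_mult_distrib)
  qed
  have "class_radius (starlike_sub (\<lambda>z. E (csqrt z))) class_F1
      = class_radius (starlike_order (1 / 2)) class_F1"
  proof (rule class_radius_starlike_sub[where \<psi> = "\<lambda>w. (T (csqrt ((w - 1) / 2)))\<^sup>2"])
    have v: "(w - 1) / 2 \<in> ball 0 ((1 / 2)\<^sup>2)" "csqrt ((w - 1) / 2) \<in> ball 0 (1 / 2)"
      if "w \<in> ball 1 (1 - 1 / 2)" for w :: complex
    proof -
      have "norm (w - 1) < 1 / 2" using that by (simp only: in_ball_1_iff)
      then show v: "(w - 1) / 2 \<in> ball 0 ((1 / 2)\<^sup>2)" by (simp add: norm_divide power2_eq_square)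
      then have "norm ((w - 1) / 2) < (1 / 2)\<^sup>2" by (simp only: mem_ball_0)
      then have "sqrt (norm ((w - 1) / 2)) < 1 / 2" by (intro real_less_lsqrt) simp_all
      then show "csqrt ((w - 1) / 2) \<in> ball 0 (1 / 2)"
        by (simp only: mem_ball_0 norm_csqrt)
    qed
    have "((\<lambda>v. (T (csqrt v))\<^sup>2) \<circ> (\<lambda>w. (w - 1) / 2)) holomorphic_on ball 1 (1 - 1 / 2)"
      by (rule holomorphic_on_compose_gen[OF _ even_comp_csqrt_holomorphic[OF Thol Teven]])
         (use v in \<open>auto intro!: holomorphic_intros\<close>)
    then show "(\<lambda>w. (T (csqrt ((w - 1) / 2)))\<^sup>2) holomorphic_on ball 1 (1 - 1 / 2)"
      by (simp add: o_def)
    show "(T (csqrt ((w - 1) / 2)))\<^sup>2 \<in> unit_disk \<and> E (csqrt ((T (csqrt ((w - 1) / 2)))\<^sup>2)) = w"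
      if w: "w \<in> ball 1 (1 - 1 / 2)" for w
    proof
      let ?v = "csqrt ((w - 1) / 2)"
      have T: "norm (T ?v) < 1" using T1 v(2)[OF w] by blast
      then show "(T ?v)\<^sup>2 \<in> unit_disk" by (simp add: norm_power abs_square_less_1)
      have "(csqrt ((T ?v)\<^sup>2))\<^sup>2 = (T ?v)\<^sup>2" by (rule power2_csqrt)
      then have "csqrt ((T ?v)\<^sup>2) = T ?v \<or> csqrt ((T ?v)\<^sup>2) = - T ?v"
        by (simp only: power2_eq_iff)
      then have "E (csqrt ((T ?v)\<^sup>2)) = E (T ?v)" using Eeven[of "T ?v"] T by auto
      also have "\<dots> = 1 + 2 * ?v\<^sup>2" by (rule ET[OF v(2)[OF w]])
      also have "\<dots> = w" unfolding power2_csqrt by (simp add: field_simps)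
      finally show "E (csqrt ((T ?v)\<^sup>2)) = w" .
    qed
    show "E (csqrt z) \<noteq> of_real (1 / 2)" if z: "z \<in> unit_disk" for z
    proof
      let ?u = "(1 + csqrt z) / (1 - csqrt z)"
      have "norm (csqrt z) < 1" using z by (simp del: csqrt.sel)
      \<comment> \<open>The value 1/2 would need a logarithm equal to i pi/2 up to sign, but the
        argument of a point in the open right half-plane stays below pi/2 in modulus.\<close>
      then have u: "\<bar>Im (Ln ?u)\<bar> < pi / 2"
        by (intro Re_Ln_pos_lt_imp Re_half_plane_map_pos)
      assume "E (csqrt z) = of_real (1 / 2)"
      then have X: "of_real (2 / pi\<^sup>2) * (Ln ?u)\<^sup>2 = of_real (1 / 2) - 1"
        unfolding E_def by (subst eq_diff_eq) (simp only: add.commute)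
      have "(Ln ?u)\<^sup>2 = of_real (pi\<^sup>2 / 2) * (of_real (2 / pi\<^sup>2) * (Ln ?u)\<^sup>2)"
        by simp
      also have "\<dots> = (\<i> * of_real (pi / 2))\<^sup>2"
        unfolding X by (simp add: power2_eq_square algebra_simps)
      finally have "(Ln ?u)\<^sup>2 = (\<i> * of_real (pi / 2))\<^sup>2" .
      then have "Ln ?u = \<i> * of_real (pi / 2) \<or> Ln ?u = - (\<i> * of_real (pi / 2))"
        by (simp only: power2_eq_iff)
      then have "Im (Ln ?u) = pi / 2 \<or> Im (Ln ?u) = - (pi / 2)"
        by (elim disjE) (simp_all only:, simp_all)
      then show False using u by linarith
    qed
    show "(T (csqrt ((1 - 1) / 2)))\<^sup>2 = 0" by (simp add: T_def)
  qed (use E1 in auto)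
  then show ?thesis unfolding starlike_P_def E_def .
qed

section \<open>The lemniscate region\<close>

text \<open>The Moebius map z/(2 + z) sends |z| \<le> r onto the disk with real diameter from -r/(2
  - r) to r/(2 + r); its centre is -r^2/(4 - r^2) and its radius 2r/(4 - r^2). This is exact at the
  right end.\<close>

lemma s_fun_class_F1_center:
  assumes f: "f \<in> class_F1" and z: "norm z \<le> r" and r: "r < 1"
  shows "norm (s_fun f z - of_real (1 - r\<^sup>2 / (4 - r\<^sup>2))) \<le> 2 * r / (4 - r\<^sup>2) + 4 * r / (1 - r\<^sup>2)"
proof -
  have r0: "0 \<le> r" using z norm_ge_zero order_trans by blast
  have r2: "r\<^sup>2 < 1" "(norm z)\<^sup>2 \<le> r\<^sup>2" using r r0 z by (auto simp: abs_square_less_1 intro: power_mono)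
  have zin: "z \<in> unit_disk" using z r by simp
  have two: "2 + z \<noteq> 0" by (rule two_plus_nonzero[OF zin])
  let ?c = "complex_of_real (r\<^sup>2)"
  have c4: "4 - ?c \<noteq> 0" using r2 by (simp add: complex_eq_iff)
  have eq: "z / (2 + z) + ?c / (4 - ?c) = (4 * z + 2 * ?c) / ((2 + z) * (4 - ?c))"
    using two c4 by (simp add: divide_simps) (simp add: algebra_simps)
  have num: "norm (4 * z + 2 * ?c) \<le> 2 * r * norm (2 + z)"
  proof (rule power2_le_imp_le)
    have "0 \<le> (4 - r\<^sup>2) * (r\<^sup>2 - (norm z)\<^sup>2)"
      using r2 by (intro mult_nonneg_nonneg) auto
    moreover have "(2 * r * norm (2 + z))\<^sup>2 - (norm (4 * z + 2 * ?c))\<^sup>2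
        = 4 * ((4 - r\<^sup>2) * (r\<^sup>2 - (norm z)\<^sup>2))"
      unfolding power_mult_distrib
      by (simp only: cmod_power2) (simp add: power2_eq_square algebra_simps)
    ultimately show "(norm (4 * z + 2 * ?c))\<^sup>2 \<le> (2 * r * norm (2 + z))\<^sup>2" by linarith
  qed (use r0 in auto)
  have "norm (4 - ?c) = 4 - r\<^sup>2"
  proof -
    have "4 - ?c = of_real (4 - r\<^sup>2)" by simp
    then show ?thesis using r2 by (simp only: norm_of_real)
  qed
  then have "norm (z / (2 + z) + ?c / (4 - ?c)) = norm (4 * z + 2 * ?c) / (norm (2 + z) * (4 - r\<^sup>2))"
    by (simp only: eq norm_divide norm_mult)
  also have "\<dots> \<le> (2 * r * norm (2 + z)) / (norm (2 + z) * (4 - r\<^sup>2))"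
    using num r2 by (intro divide_right_mono) auto
  also have "\<dots> = 2 * r / (4 - r\<^sup>2)" using two by simp
  finally have "norm (z / (2 + z) + ?c / (4 - ?c)) \<le> 2 * r / (4 - r\<^sup>2)" .
  moreover have "norm (s_fun f z - (1 + z / (2 + z))) \<le> 4 * r / (1 - r\<^sup>2)"
  proof (rule order_trans[OF s_fun_class_F1[OF f zin]])
    show "4 * norm z / (1 - (norm z)\<^sup>2) \<le> 4 * r / (1 - r\<^sup>2)"
      using z r2 r0 by (intro frac_le) auto
  qed
  moreover have "s_fun f z - of_real (1 - r\<^sup>2 / (4 - r\<^sup>2))
      = (z / (2 + z) + ?c / (4 - ?c)) + (s_fun f z - (1 + z / (2 + z)))"
    by simp
  ultimately show ?thesis by (metis norm_triangle_mono)
qed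

text \<open>2 sqrt 2/3 is the centre of the osculating circle of the lemniscate |w^2 - 1| = 1 at its
  vertex sqrt 2. With t = |w|^2, a point of the disk outside the lemniscate would satisfy (t - 2)^2
  < 0.\<close>

lemma lemniscate_disk:
  fixes a :: real and w :: complex
  assumes a: "2 * sqrt 2 / 3 \<le> a" and w: "norm (w - of_real a) < sqrt 2 - a"
  shows "0 < Re w" "norm (w\<^sup>2 - 1) < 1"
proof -
  have s2: "0 < sqrt (2::real)" by simp
  have b: "\<bar>Re w - a\<bar> < sqrt 2 - a"
    using abs_Re_le_cmod[of "w - of_real a"] w by simp
  then show pos: "0 < Re w" using a s2 by linarith
  show "norm (w\<^sup>2 - 1) < 1"
  proof (rule ccontr)
    define t where "t = (norm w)\<^sup>2"
    let ?x = "Re w"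
    have tx: "t = ?x\<^sup>2 + (Im w)\<^sup>2" by (simp only: t_def cmod_power2)
    assume "\<not> norm (w\<^sup>2 - 1) < 1"
    then have "1 \<le> (norm (w\<^sup>2 - 1))\<^sup>2" by simp
    also have "\<dots> = t\<^sup>2 + 2 * t - 4 * ?x\<^sup>2 + 1"
      unfolding tx by (simp only: cmod_power2) (simp add: power2_eq_square algebra_simps)
    finally have x2: "4 * ?x\<^sup>2 \<le> t\<^sup>2 + 2 * t" by simp
    have "(norm (w - of_real a))\<^sup>2 < (sqrt 2 - a)\<^sup>2" using w by (intro power_strict_mono) auto
    moreover have "(norm (w - of_real a))\<^sup>2 = t - 2 * a * ?x + a\<^sup>2"
      unfolding tx by (simp only: cmod_power2) (simp add: power2_eq_square algebra_simps)
    ultimately have "t - 2 + 2 * a * (sqrt 2 - ?x) < 0"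
      by (simp add: power2_eq_square algebra_simps)
    \<comment> \<open>As Re w < sqrt 2, the centre \<open>a\<close> may be replaced by its least
      allowed value.\<close>
    moreover have "2 * (2 * sqrt 2 / 3) * (sqrt 2 - ?x) \<le> 2 * a * (sqrt 2 - ?x)"
      using a b by (intro mult_right_mono) auto
    moreover have "2 * (2 * sqrt 2 / 3) * (sqrt 2 - ?x) = 8 / 3 - 4 * sqrt 2 / 3 * ?x"
      by (simp add: right_diff_distrib)
    ultimately have "t + 2 / 3 < 4 * sqrt 2 / 3 * ?x" by linarith
    moreover have "0 \<le> t" by (simp add: t_def)
    ultimately have "(t + 2 / 3)\<^sup>2 < (4 * sqrt 2 / 3 * ?x)\<^sup>2" by (intro power_strict_mono) auto
    also have "\<dots> = 8 / 9 * (4 * ?x\<^sup>2)" by (simp add: power2_eq_square)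
    also have "\<dots> \<le> 8 / 9 * (t\<^sup>2 + 2 * t)" using x2 by (rule mult_left_mono) simp
    finally have "(t - 2)\<^sup>2 < 0" by (simp add: power2_eq_square algebra_simps)
    then show False using zero_le_power2[of "t - 2"] by linarith
  qed
qed

lemma class_radius_starlike_L:
  assumes \<rho>: "0 < \<rho>" "\<rho> < 1" "right_dev \<rho> = sqrt 2 - 1"
  shows "class_radius starlike_L class_F1 = \<rho>"
proof (rule class_radius_eqI[OF \<rho>(1,2)])
  have s2: "sqrt (2::real) < 1.42"
    by (rule real_less_lsqrt) (simp_all add: power2_eq_square)
  have hol: "(\<lambda>z. csqrt (1 + z)) holomorphic_on unit_disk"
    by (intro holomorphic_intros one_plus_not_nonpos_Reals) auto
  fix f r assume f: "f \<in> class_F1" and r: "0 < r" "r < \<rho>"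
  have r1: "r < 1" using r \<rho> by simp
  have rr: "r\<^sup>2 < 1" using r r1 by (simp add: abs_square_less_1)
  define a where "a = 1 - r\<^sup>2 / (4 - r\<^sup>2)"
  have dev: "right_dev r < sqrt 2 - 1"
    using right_dev_strict_mono[of r \<rho>] r \<rho> by simp
  \<comment> \<open>A crude bound r < 0.11 is enough to bring the centre \<open>a\<close> above 2
    sqrt 2/3.\<close>
  have "4 * r / 1 \<le> 4 * r / (1 - r\<^sup>2)" using r rr by (intro divide_left_mono) auto
  moreover have "0 \<le> r / (2 + r)" using r by simp
  ultimately have "4 * r < 0.42" using dev s2 by (simp add: right_dev_def)
  then have "r * r \<le> 0.11 * 0.11" using r by (intro mult_mono) auto
  moreover have "r\<^sup>2 / (4 - r\<^sup>2) \<le> r\<^sup>2 / 1" using rr by (intro divide_left_mono) auto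
  ultimately have a: "2 * sqrt 2 / 3 \<le> a" using s2 by (simp add: a_def power2_eq_square)
  \<comment> \<open>The right end of the disk of \<open>s_fun_class_F1_center\<close> is therefore
    \<open>1 + right_dev r\<close>, which lies below sqrt 2.\<close>
  have "2 * r / (4 - r\<^sup>2) - r\<^sup>2 / (4 - r\<^sup>2) = r / (2 + r)"
  proof -
    have "2 * r - r\<^sup>2 = r * (2 - r)" "4 - r\<^sup>2 = (2 + r) * (2 - r)"
      by (simp_all add: power2_eq_square algebra_simps)
    then show ?thesis using r1 r by (simp flip: diff_divide_distrib)
  qed
  then have ra: "2 * r / (4 - r\<^sup>2) + 4 * r / (1 - r\<^sup>2) < sqrt 2 - a"
    using dev by (simp add: right_dev_def a_def)
  note d = dilate_class_F1[OF f r(1) r1]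
  have L: "0 < Re (s_fun (dilate r f) z)" "norm ((s_fun (dilate r f) z)\<^sup>2 - 1) < 1"
    if "z \<in> unit_disk" for z
  proof -
    have "norm (s_fun (dilate r f) z - of_real a) < sqrt 2 - a"
      using s_fun_class_F1_center[OF f less_imp_le[OF d(4)[OF that]] r1] ra
      unfolding d(3)[OF that] a_def by linarith
    from lemniscate_disk[OF a this]
    show "0 < Re (s_fun (dilate r f) z)" "norm ((s_fun (dilate r f) z)\<^sup>2 - 1) < 1" .
  qed
  define \<omega> where "\<omega> = (\<lambda>z. (s_fun (dilate r f) z)\<^sup>2 - 1)"
  have "\<omega> holomorphic_on unit_disk" unfolding \<omega>_def by (intro holomorphic_intros d(2))
  moreover have "\<omega> ` unit_disk \<subseteq> unit_disk" using L(2) by (auto simp: \<omega>_def)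
  moreover have "\<omega> 0 = 0" by (simp add: \<omega>_def s_fun_def)
  moreover have "s_fun (dilate r f) z = csqrt (1 + \<omega> z)" if "z \<in> unit_disk" for z
    using csqrt_square[of "s_fun (dilate r f) z"] L(1)[OF that] by (simp add: \<omega>_def)
  ultimately show "dilate r f \<in> starlike_L"
    unfolding starlike_L_def starlike_sub_def subordinate_def using d(1,2) hol by blast
next
  fix r assume r: "\<rho> < r" "r < 1"
  show "dilate r extremal \<notin> starlike_L"
  proof
    \<comment> \<open>The dilation carries this point to \<rho>, where \<open>s_fun extremal\<close>
      is sqrt 2; that would force the Schwarz function to take the value 1.\<close>
    let ?z = "complex_of_real (\<rho> / r)"
    have z: "?z \<in> unit_disk" using r \<rho> by (simp add: norm_divide)
    assume "dilate r extremal \<in> starlike_L"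
    then obtain \<omega> where \<omega>: "\<omega> ` unit_disk \<subseteq> unit_disk"
        "\<forall>z\<in>unit_disk. s_fun (dilate r extremal) z = csqrt (1 + \<omega> z)"
      unfolding starlike_L_def starlike_sub_def subordinate_def by blast
    have "s_fun (dilate r extremal) ?z = s_fun extremal (of_real \<rho>)"
      using dilate_class_F1(3)[OF extremal_in_class_F1 _ r(2) z] r \<rho> by simp
    also have "\<dots> = of_real (1 + right_dev \<rho>)"
      using \<rho> by (subst s_fun_extremal) (auto simp: right_dev_def algebra_simps)
    finally have "csqrt (1 + \<omega> ?z) = of_real (sqrt 2)" using \<omega>(2) z \<rho>(3) by simp
    then have "1 + \<omega> ?z = (of_real (sqrt 2))\<^sup>2" by (metis power2_csqrt)
    then have "\<omega> ?z = 1" by (simp flip: of_real_power)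
    moreover have "\<omega> ?z \<in> unit_disk" using \<omega>(1) z by blast
    ultimately show False by simp
  qed
qed (rule extremal_in_class_F1)

theorem theorem2p1:
  shows "(\<forall>\<alpha>::real. 0 \<le> \<alpha> \<and> \<alpha> < 1 \<longrightarrow>
      smallest_positive_root
        (\<lambda>r. (\<alpha> - 2) * r ^ 3 - (2 * \<alpha> + 2) * r ^ 2 + (10 - \<alpha>) * r + 2 * \<alpha> - 2)
        (class_radius (starlike_order \<alpha>) class_F1)) \<and>
    smallest_positive_root
        (\<lambda>r. (2 - sqrt 2) * r ^ 3 - (2 + 2 * sqrt 2) * r ^ 2 + (sqrt 2 - 10) * r + 2 * sqrt 2 - 2)
        (class_radius starlike_L class_F1) \<and>
    class_radius starlike_P class_F1 = class_radius (starlike_order (1 / 2)) class_F1 \<and>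
    class_radius starlike_e class_F1 = class_radius (starlike_order (1 / exp 1)) class_F1 \<and>
    class_radius starlike_sin class_F1 = class_radius (starlike_order (1 - sin 1)) class_F1 \<and>
    class_radius starlike_lune class_F1 = class_radius (starlike_order (sqrt 2 - 1)) class_F1 \<and>
    class_radius starlike_R class_F1 = class_radius (starlike_order (2 * (sqrt 2 - 1))) class_F1 \<and>
    class_radius starlike_C class_F1 = class_radius (starlike_order (1 / 3)) class_F1"
proof (intro conjI allI impI)
  fix \<alpha> :: real assume \<alpha>: "0 \<le> \<alpha> \<and> \<alpha> < 1"
  then obtain \<rho> where \<rho>: "0 < \<rho>" "\<rho> < 1" "left_dev \<rho> = 1 - \<alpha>"
    using left_dev_root by blast
  show "smallest_positive_root
      (\<lambda>r. (\<alpha> - 2) * r ^ 3 - (2 * \<alpha> + 2) * r ^ 2 + (10 - \<alpha>) * r + 2 * \<alpha> - 2)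
      (class_radius (starlike_order \<alpha>) class_F1)"
    unfolding class_radius_starlike_order[OF conjunct1[OF \<alpha>] \<rho>]
  proof (rule smallest_positive_rootI[where d = left_dev, OF \<rho> left_dev_strict_mono])
    fix r :: real assume r: "0 \<le> r" "r < 1"
    then have "(2 - r) * (1 - r\<^sup>2) \<noteq> 0" by (auto simp: power2_eq_1_iff)
    then show "(\<alpha> - 2) * r ^ 3 - (2 * \<alpha> + 2) * r ^ 2 + (10 - \<alpha>) * r + 2 * \<alpha> - 2 = 0
        \<longleftrightarrow> left_dev r = 1 - \<alpha>"
      unfolding left_dev_polynomial[OF r] by simp
  qed
next
  obtain \<rho> where \<rho>: "0 < \<rho>" "\<rho> < 1" "right_dev \<rho> = sqrt 2 - 1"
    using right_dev_root by blast
  show "smallest_positive_root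
      (\<lambda>r. (2 - sqrt 2) * r ^ 3 - (2 + 2 * sqrt 2) * r ^ 2 + (sqrt 2 - 10) * r + 2 * sqrt 2 - 2)
      (class_radius starlike_L class_F1)"
    unfolding class_radius_starlike_L[OF \<rho>]
  proof (rule smallest_positive_rootI[where d = right_dev, OF \<rho> right_dev_strict_mono])
    fix r :: real assume r: "0 \<le> r" "r < 1"
    then have "(2 + r) * (1 - r\<^sup>2) \<noteq> 0" by (auto simp: power2_eq_1_iff)
    then show "(2 - sqrt 2) * r ^ 3 - (2 + 2 * sqrt 2) * r ^ 2 + (sqrt 2 - 10) * r + 2 * sqrt 2 - 2 = 0
        \<longleftrightarrow> right_dev r = sqrt 2 - 1"
      unfolding right_dev_polynomial[OF r] by auto
  qed
qed (rule class_radius_starlike_P class_radius_starlike_e class_radius_starlike_sin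
    class_radius_starlike_lune class_radius_starlike_R class_radius_starlike_C)+

end
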